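(* Let $K$ be a Galois number field with ring of integers $\mathcal{O}_K$, let $n$ be a nonzero rational integer, and let $\mathrm{Cl}(\mathcal{O}_K[\frac{1}{n}])$ be the ideal class group of $\mathcal{O}_K[\frac{1}{n}]$. Then the action $$\sigma \cdot [\mathfrak{P}] = [\sigma(\mathfrak{P})], \qquad \sigma \in \mathrm{Gal}(K/\mathbb{Q}),\ [\mathfrak{P}] \in \mathrm{Cl}\left(\mathcal{O}_K\left[\tfrac{1}{n}\right]\right),$$ is a well-defined, norm-like action of $\mathrm{Gal}(K/\mathbb{Q})$ on $\mathrm{Cl}(\mathcal{O}_K[\frac{1}{n}])$.
   Context: A Galois number field is a number field that is Galois over $\mathbb{Q}$. Let $G$ and $A$ be groups with $A$ abelian. A function $G \times A \to A$, $(g,a) \mapsto g \cdot a$, is called a norm-like action if: (1) $g_1 \cdot (g_2 \cdot a) = (g_1 g_2)\cdot a$ for all $g_1,g_2 \in G$, $a \in A$; (2) $e_G \cdot a = a$ for all $a \in A$; (3) $g \cdot (a_1 a_2) = (g \cdot a_1)(g \cdot a_2)$ for all $g \in G$, $a_1,a_2 \in A$; (4) $\prod_{g \in G} (g \cdot a) = e_A$ for all $a \in A$. *)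

theory Defs
  imports
    "HOL-Algebra.Algebraic_Closure_Type"
    "HOL-Algebra.Ideal_Product"
    "HOL-Algebra.Bij"
    "HOL-Computational_Algebra.Polynomial"
begin

text \<open>
  Number fields are subfields of an arbitrary ambient field of characteristic 0, given by a type.
  The ambient field is viewed as a HOL-Algebra ring through \<^const>\<open>ring_of_type_algebra\<close>; a subring
  \<open>S\<close> of it, as a ring in its own right, is the same record with carrier \<open>S\<close>.
\<close>

abbreviation subring_of :: "'a::field_char_0 set \<Rightarrow> 'a ring" where
  "subring_of S \<equiv> ring_of_type_algebra\<lparr>carrier := S\<rparr>"

section \<open>Galois number fields\<close>

definition galois_group :: "'a::field_char_0 set \<Rightarrow> 'a set \<Rightarrow> ('a \<Rightarrow> 'a) monoid" where
  "galois_group F L = BijGroup L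
     \<lparr>carrier := {\<sigma> \<in> Bij L. \<sigma> \<in> ring_hom (subring_of L) (subring_of L) \<and> (\<forall>x\<in>F. \<sigma> x = x)}\<rparr>"

definition number_field :: "'a::field_char_0 set \<Rightarrow> bool" where
  "number_field K \<longleftrightarrow>
     subfield K ring_of_type_algebra \<and> ring.finite_dimension ring_of_type_algebra \<rat> K"

text \<open>A finite extension is called Galois if the base field is the fixed field of its automorphism group.\<close>

definition galois_number_field :: "'a::field_char_0 set \<Rightarrow> bool" where
  "galois_number_field K \<longleftrightarrow>
     number_field K \<and> {x \<in> K. \<forall>\<sigma>\<in>carrier (galois_group \<rat> K). \<sigma> x = x} = \<rat>"

definition ring_of_integers :: "'a::field_char_0 set \<Rightarrow> 'a set" where
  "ring_of_integers K = {x \<in> K. algebraic_int x}"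

definition ring_adjoin :: "'a::field_char_0 set \<Rightarrow> 'a \<Rightarrow> 'a set" where
  "ring_adjoin R x = {poly p x | p. \<forall>i. coeff p i \<in> R}"

section \<open>The ideal class group\<close>

text \<open>
  Here \<open>R\<close> is a subring of the ambient field with field of fractions \<open>K\<close>. The class group is the
  group of nonzero fractional ideals modulo the principal ones, as for a Dedekind domain.
\<close>

definition fractional_ideal :: "'a::field_char_0 set \<Rightarrow> 'a set \<Rightarrow> 'a set \<Rightarrow> bool" where
  "fractional_ideal R K I \<longleftrightarrow>
     I \<subseteq> K \<and> additive_subgroup I ring_of_type_algebra \<and> (\<forall>r\<in>R. \<forall>x\<in>I. r * x \<in> I) \<and>
     (\<exists>d\<in>R - {0}. \<forall>x\<in>I. d * x \<in> R)"

text \<open>\<^const>\<open>ideal_prod\<close> consists of the finite sums of products, also for fractional ideals.\<close>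

definition fractional_ideal_group :: "'a::field_char_0 set \<Rightarrow> 'a set \<Rightarrow> 'a set monoid" where
  "fractional_ideal_group R K =
     \<lparr>carrier = {I. fractional_ideal R K I \<and> I \<noteq> {0}},
      monoid.mult = ideal_prod ring_of_type_algebra,
      one = R\<rparr>"

definition principal_fractional_ideals :: "'a::field_char_0 set \<Rightarrow> 'a set \<Rightarrow> 'a set set" where
  "principal_fractional_ideals R K = {(\<lambda>r. x * r) ` R | x. x \<in> K - {0}}"

definition class_group :: "'a::field_char_0 set \<Rightarrow> 'a set \<Rightarrow> 'a set set monoid" where
  "class_group R K = fractional_ideal_group R K Mod principal_fractional_ideals R K"

definition ideal_class :: "'a::field_char_0 set \<Rightarrow> 'a set \<Rightarrow> 'a set \<Rightarrow> 'a set set" where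
  "ideal_class R K I = principal_fractional_ideals R K #>\<^bsub>fractional_ideal_group R K\<^esub> I"

section \<open>Norm-like actions\<close>

text \<open>
  The product over \<open>G\<close> only makes sense for finite \<open>G\<close>; finiteness is required explicitly since
  \<^const>\<open>finprod\<close> over an infinite index set is the unit element.
\<close>

definition norm_like_action ::
  "('g, 'm) monoid_scheme \<Rightarrow> ('a, 'n) monoid_scheme \<Rightarrow> ('g \<Rightarrow> 'a \<Rightarrow> 'a) \<Rightarrow> bool" where
  "norm_like_action G A act \<longleftrightarrow>
     group G \<and> comm_group A \<and> finite (carrier G) \<and>
     (\<forall>g\<in>carrier G. \<forall>a\<in>carrier A. act g a \<in> carrier A) \<and>
     (\<forall>g1\<in>carrier G. \<forall>g2\<in>carrier G. \<forall>a\<in>carrier A. act g1 (act g2 a) = act (g1 \<otimes>\<^bsub>G\<^esub> g2) a) \<and>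
     (\<forall>a\<in>carrier A. act \<one>\<^bsub>G\<^esub> a = a) \<and>
     (\<forall>g\<in>carrier G. \<forall>a1\<in>carrier A. \<forall>a2\<in>carrier A. act g (a1 \<otimes>\<^bsub>A\<^esub> a2) = act g a1 \<otimes>\<^bsub>A\<^esub> act g a2) \<and>
     (\<forall>a\<in>carrier A. finprod A (\<lambda>g. act g a) (carrier G) = \<one>\<^bsub>A\<^esub>)"

end

theory Submission
  imports Defs
begin

text \<open>
  Everything rests on one computation: for a fractional ideal \<open>I\<close> of \<open>R = O\<^sub>K[1/n]\<close>, the product
  \<open>\<Prod>\<sigma>. \<sigma>(I)\<close> is principal, generated by a rational number. This is the norm condition, and it also
  makes every fractional ideal invertible, so that no prime factorisation of ideals is needed.
  If \<open>I\<close> consists of algebraic integers, let \<open>c\<close> generate the group of integers in \<open>\<Prod>\<sigma>. \<sigma>(I)\<close>. Given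
  \<open>x \<sigma> \<in> I\<close> for all \<open>\<sigma>\<close>, take a polynomial \<open>f\<close> whose coefficients are the \<open>x \<sigma>\<close>. The coefficients of the
  Galois invariant polynomial \<open>\<Prod>\<sigma>. \<sigma>(f)\<close> are integers in \<open>\<Prod>\<sigma>. \<sigma>(I)\<close>, hence divisible by \<open>c\<close>, and by
  Kronecker's theorem \<open>c\<close> then divides \<open>\<Prod>\<sigma>. \<sigma>(x \<sigma>)\<close>. Kronecker's theorem is Gauss's lemma in each
  valuation ring, as the algebraic integers are the intersection of all valuation rings of the field.
\<close>

section \<open>Valuation rings and algebraic integers\<close>

text \<open>The obstacle is that fractional ideals are not known to be invertible, and the quotient
  by the principal ones is a group only once they are. The norm is therefore computed in the
  commutative monoid of fractional ideals, without inverses or cancellation. The detour through f is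
  forced because a single product \<Prod>\<sigma>. \<sigma>(x \<sigma>) with different x \<sigma> is
  not Galois invariant. It is, however, a product of coefficients, one from each factor of an
  invariant polynomial. Invariance makes the coefficients of that polynomial rational, integrality
  makes them integers, and c exists because every group of integers is cyclic. Gauss's lemma has no
  direct meaning over O_K, where the ideal of the coefficients need not be principal. In a valuation
  ring divisibility is total, so the content is simply one of the coefficients. Elements of O_K[1/n]
  need not be algebraic integers. Each becomes one after multiplication by a power of n, which is a
  unit of that ring, so the case of integral elements suffices.\<close>

locale field_subring =
  fixes S :: "'a::field_char_0 set"
  assumes one_mem [simp, intro]: "1 \<in> S"
    and diff_mem [intro]: "x \<in> S \<Longrightarrow> y \<in> S \<Longrightarrow> x - y \<in> S"
    and mult_mem [intro]: "x \<in> S \<Longrightarrow> y \<in> S \<Longrightarrow> x * y \<in> S"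
begin

lemma zero_mem [simp, intro]: "0 \<in> S"
  using diff_mem[OF one_mem one_mem] by simp

lemma uminus_mem [intro]: "x \<in> S \<Longrightarrow> - x \<in> S"
  using diff_mem[OF zero_mem] by force

lemma add_mem [intro]: "x \<in> S \<Longrightarrow> y \<in> S \<Longrightarrow> x + y \<in> S"
  using diff_mem[of x "- y"] by auto

lemma power_mem [intro]: "x \<in> S \<Longrightarrow> x ^ k \<in> S"
  by (induction k) auto

lemma sum_mem [intro]: "(\<And>i. i \<in> A \<Longrightarrow> f i \<in> S) \<Longrightarrow> sum f A \<in> S"
  by (induction A rule: infinite_finite_induct) auto

lemma prod_mem [intro]: "(\<And>i. i \<in> A \<Longrightarrow> f i \<in> S) \<Longrightarrow> prod f A \<in> S"
  by (induction A rule: infinite_finite_induct) auto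

lemma of_int_mem [simp, intro]: "of_int k \<in> S"
proof -
  have "of_nat m \<in> S" for m
    by (induction m) auto
  then show ?thesis
    by (cases k rule: int_cases2) auto
qed

lemma Ints_subset: "\<int> \<subseteq> S"
  by (auto elim: Ints_cases)

lemma poly_mem: "(\<And>i. coeff p i \<in> S) \<Longrightarrow> x \<in> S \<Longrightarrow> poly p x \<in> S"
  by (auto simp: poly_altdef)

lemma coeff_mult_mem:
  "(\<And>i. coeff p i \<in> S) \<Longrightarrow> (\<And>i. coeff q i \<in> S) \<Longrightarrow> coeff (p * q) i \<in> S"
  by (auto simp: coeff_mult)

lemma coeff_prod_mem:
  "(\<And>k i. k \<in> A \<Longrightarrow> coeff (f k) i \<in> S) \<Longrightarrow> coeff (prod f A) i \<in> S"
proof (induction A arbitrary: i rule: infinite_finite_induct)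
  case (insert k A)
  then show ?case
    by (simp add: coeff_mult_mem)
qed (auto simp: coeff_1)

text \<open>Division of the equation p(x) = 0 by x^e, with e one less than the degree, leaves the
  leading coefficient times x on one side and a polynomial in 1/x over S on the other. This serves
  both for monic p (integral closedness) and for clearing denominators.\<close>

lemma mult_root_power_mem:
  assumes p: "\<And>i. coeff p i \<in> S" and "poly p x = 0" "p \<noteq> 0" and inv: "inverse x \<in> S"
  shows "lead_coeff p * x \<in> S"
proof (cases "x = 0")
  case False
  define d where "d = degree p"
  have "d \<noteq> 0"
  proof
    assume "d = 0"
    then obtain a where "p = [:a:]"
      unfolding d_def by (metis degree_eq_zeroE)
    then show False
      using assms by simp
  qed
  then obtain e where d: "d = Suc e"
    using not0_implies_Suc by blast
  have "0 = (\<Sum>i<Suc d. coeff p i * x ^ i)"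
    using assms(2) by (simp add: poly_altdef d_def lessThan_Suc_atMost)
  then have "lead_coeff p * x ^ d = - (\<Sum>i<d. coeff p i * x ^ i)"
    by (simp add: d_def eq_neg_iff_add_eq_0 add.commute)
  then have "lead_coeff p * x = - (\<Sum>i<d. coeff p i * x ^ i) * inverse x ^ e"
    using False by (simp add: d field_simps)
  also have "\<dots> = - (\<Sum>i<d. coeff p i * inverse x ^ (e - i))"
  proof -
    have "(\<Sum>i<d. coeff p i * x ^ i) * inverse x ^ e = (\<Sum>i<d. coeff p i * inverse x ^ (e - i))"
      unfolding sum_distrib_right using False
      by (intro sum.cong refl) (simp add: d power_diff field_simps)
    then show ?thesis
      by simp
  qed
  also have "\<dots> \<in> S"
    using p inv by auto
  finally show ?thesis .
qed auto

end

lemma field_subring_Ints: "field_subring (\<int> :: 'a::field_char_0 set)"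
  by unfold_locales auto

lemma ring_adjoin_superset: "0 \<in> S \<Longrightarrow> S \<subseteq> ring_adjoin S x"
proof
  fix s assume "0 \<in> S" "s \<in> S"
  then show "s \<in> ring_adjoin S x"
    unfolding ring_adjoin_def by (intro CollectI exI[of _ "[:s:]"]) (auto simp: coeff_pCons split: nat.split)
qed

lemma mem_ring_adjoin: "0 \<in> S \<Longrightarrow> 1 \<in> S \<Longrightarrow> x \<in> ring_adjoin S x"
  unfolding ring_adjoin_def
  by (intro CollectI exI[of _ "[:0, 1:]"]) (auto simp: coeff_pCons split: nat.split)

lemma (in field_subring) field_subring_ring_adjoin: "field_subring (ring_adjoin S x)"
proof
  show "1 \<in> ring_adjoin S x"
    using ring_adjoin_superset[of S x] by auto
  show "a - b \<in> ring_adjoin S x" if "a \<in> ring_adjoin S x" "b \<in> ring_adjoin S x" for a b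
  proof -
    obtain p q where "a = poly p x" "\<forall>i. coeff p i \<in> S" "b = poly q x" "\<forall>i. coeff q i \<in> S"
      using \<open>a \<in> _\<close> \<open>b \<in> _\<close> unfolding ring_adjoin_def by auto
    then have "a - b = poly (p - q) x" "\<forall>i. coeff (p - q) i \<in> S"
      by auto
    then show ?thesis
      unfolding ring_adjoin_def by blast
  qed
  show "a * b \<in> ring_adjoin S x" if "a \<in> ring_adjoin S x" "b \<in> ring_adjoin S x" for a b
  proof -
    obtain p q where "a = poly p x" "\<forall>i. coeff p i \<in> S" "b = poly q x" "\<forall>i. coeff q i \<in> S"
      using \<open>a \<in> _\<close> \<open>b \<in> _\<close> unfolding ring_adjoin_def by auto
    then have "a * b = poly (p * q) x" "\<forall>i. coeff (p * q) i \<in> S"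
      by (auto intro: coeff_mult_mem)
    then show ?thesis
      unfolding ring_adjoin_def by blast
  qed
qed

lemma subset_chain_Union_field_subring:
  assumes "\<C> \<noteq> {}" "\<And>S T. S \<in> \<C> \<Longrightarrow> T \<in> \<C> \<Longrightarrow> S \<subseteq> T \<or> T \<subseteq> S"
    and "\<And>S. S \<in> \<C> \<Longrightarrow> field_subring S"
  shows "field_subring (\<Union>\<C>)"
proof
  show "1 \<in> \<Union>\<C>"
    using assms(1,3) field_subring.one_mem by blast
  fix x y assume "x \<in> \<Union>\<C>" "y \<in> \<Union>\<C>"
  then obtain S where "S \<in> \<C>" "x \<in> S" "y \<in> S"
    using assms(2) by blast
  then show "x - y \<in> \<Union>\<C>" "x * y \<in> \<Union>\<C>"
    using assms(3) field_subring.diff_mem field_subring.mult_mem by blast+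
qed

locale valuation_ring = field_subring V for V :: "'a::field_char_0 set" +
  assumes inverse_mem: "x \<notin> V \<Longrightarrow> inverse x \<in> V"

text \<open>A subring that is maximal among those containing \<open>y = 1/x\<close> but not \<open>x\<close> is a valuation ring.\<close>

locale maximal_avoiding = field_subring V for V :: "'a::field_char_0 set" +
  fixes x :: 'a
  assumes inverse_x_mem: "inverse x \<in> V" and x_notin: "x \<notin> V"
    and maximal: "field_subring W \<Longrightarrow> V \<subseteq> W \<Longrightarrow> x \<notin> W \<Longrightarrow> W = V"
begin

lemma x_nonzero: "x \<noteq> 0"
  using x_notin by auto

text \<open>By maximality: V[z] is strictly larger than V, so it cannot avoid x.\<close>

lemma x_in_ring_adjoin:
  assumes "z \<notin> V"
  shows "x \<in> ring_adjoin V z"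
proof (rule ccontr)
  assume "x \<notin> ring_adjoin V z"
  then have "ring_adjoin V z = V"
    by (intro maximal field_subring_ring_adjoin ring_adjoin_superset) auto
  then show False
    using assms mem_ring_adjoin[of V z] by auto
qed

text \<open>This puts 1/x into the Jacobson radical of V. If 1/u were missing from V, then x would
  be a polynomial in 1/u, and clearing denominators would give x * u^m \<in> V for some m. But x * u
  = x - b, so multiplication by powers of u changes x only by elements of V, and x itself would lie
  in V.\<close>

lemma inverse_one_minus_mem:
  assumes b: "b \<in> V"
  shows "1 - inverse x * b \<noteq> 0" and "inverse (1 - inverse x * b) \<in> V"
proof -
  let ?u = "1 - inverse x * b"
  show u: "?u \<noteq> 0"
    using b x_notin x_nonzero by (auto simp: field_simps)
  show "inverse ?u \<in> V"
  proof (rule ccontr)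
    assume "inverse ?u \<notin> V"
    then obtain p where p: "x = poly p (inverse ?u)" "\<forall>i. coeff p i \<in> V"
      using x_in_ring_adjoin unfolding ring_adjoin_def by blast
    have uV: "?u \<in> V"
      using b inverse_x_mem by auto
    have "x * ?u ^ k - x \<in> V" for k
    proof (induction k)
      case (Suc k)
      have "x * ?u ^ Suc k - x = (x * ?u ^ k - x) * ?u - b"
        using x_nonzero by (simp add: field_simps)
      then show ?case
        using Suc uV b by auto
    qed auto
    moreover have "x * ?u ^ degree p \<in> V"
    proof -
      have "x * ?u ^ degree p = (\<Sum>i\<le>degree p. coeff p i * inverse ?u ^ i) * ?u ^ degree p"
        using p(1) by (simp add: poly_altdef)
      also have "\<dots> = (\<Sum>i\<le>degree p. coeff p i * ?u ^ (degree p - i))"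
        unfolding sum_distrib_right using u
        by (intro sum.cong refl) (simp add: power_diff field_simps)
      also have "\<dots> \<in> V"
        using p(2) uV by auto
      finally show ?thesis .
    qed
    ultimately have "x * ?u ^ degree p - (x * ?u ^ degree p - x) \<in> V"
      by blast
    then show False
      using x_notin by simp
  qed
qed

text \<open>The relation for 1/z yields an expression of z^m through lower powers of z, where m is
  the degree of p; substituting it for the leading term of p lowers the degree.\<close>

lemma lower_degree:
  assumes "z \<notin> V" "z \<noteq> 0"
    and p: "poly p z = x" "\<forall>i. coeff p i \<in> V"
    and q: "poly q (inverse z) = x" "\<forall>i. coeff q i \<in> V"
    and le: "degree q \<le> degree p"
  shows "\<exists>p'. degree p' < degree p \<and> poly p' z = x \<and> (\<forall>i. coeff p' i \<in> V)"
proof -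
  define m where "m = degree p"
  have "m \<noteq> 0"
  proof
    assume "m = 0"
    then obtain a where "p = [:a:]"
      unfolding m_def by (metis degree_eq_zeroE)
    then have "x = coeff p 0"
      using p by simp
    then show False
      using p x_notin by auto
  qed
  \<comment> \<open>After division of q(1/z) = x by x, the constant term is moved to the other side.
    The resulting u is a unit of V, and dividing by it writes 1 as a polynomial in 1/z over V
    without constant term.\<close>
  define u where "u = 1 - inverse x * coeff q 0"
  have u: "u \<noteq> 0" "inverse u \<in> V"
    using inverse_one_minus_mem[of "coeff q 0"] q(2) by (auto simp: u_def)
  define c where "c j = inverse u * inverse x * coeff q j" for j
  have c: "c j \<in> V" for j
    using u inverse_x_mem q(2) by (auto simp: c_def)
  have "x = coeff q 0 + (\<Sum>j\<in>{1..degree q}. coeff q j * inverse z ^ j)"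
    using q(1) by (simp add: poly_altdef atMost_atLeast0 sum.atLeast_Suc_atMost)
  then have "1 = inverse x * (coeff q 0 + (\<Sum>j\<in>{1..degree q}. coeff q j * inverse z ^ j))"
    using x_nonzero by (metis left_inverse)
  then have "u = (\<Sum>j\<in>{1..degree q}. inverse x * coeff q j * inverse z ^ j)"
    by (simp add: u_def algebra_simps sum_distrib_left)
  then have "1 = inverse u * (\<Sum>j\<in>{1..degree q}. inverse x * coeff q j * inverse z ^ j)"
    using u(1) by (metis left_inverse)
  then have one: "1 = (\<Sum>j\<in>{1..degree q}. c j * inverse z ^ j)"
    by (simp add: c_def sum_distrib_left mult.assoc)
  \<comment> \<open>This is \<open>one\<close> multiplied by z^m. The exponents m - j are genuine
    differences because q has degree at most m, and they stay below m because j starts at 1.\<close>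
  define g where "g = (\<Sum>j\<in>{1..degree q}. monom (c j) (m - j))"
  have "poly g z = (\<Sum>j\<in>{1..degree q}. c j * z ^ (m - j))"
    by (simp add: g_def poly_sum poly_monom)
  also have "\<dots> = (\<Sum>j\<in>{1..degree q}. c j * inverse z ^ j * z ^ m)"
    using le assms(2) by (intro sum.cong refl) (simp add: m_def power_diff field_simps)
  also have "\<dots> = z ^ m"
    using one by (metis mult_1 sum_distrib_right)
  finally have g: "poly g z = z ^ m" .
  have deg_g: "degree g < m"
    unfolding g_def using \<open>m \<noteq> 0\<close>
    by (intro degree_sum_less) (auto intro: le_less_trans[OF degree_monom_le])
  have g_mem: "coeff g i \<in> V" for i
    using c by (auto simp: g_def coeff_sum)
  define p' where "p' = p - monom (lead_coeff p) m + smult (lead_coeff p) g"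
  have "degree (p - monom (lead_coeff p) m) < m"
  proof (rule degree_lessI)
    show "\<forall>k\<ge>m. coeff (p - monom (lead_coeff p) m) k = 0"
      by (auto simp: m_def coeff_eq_0)
  qed (use \<open>m \<noteq> 0\<close> in auto)
  then have "degree p' < m"
    using deg_g unfolding p'_def by (intro degree_add_less) auto
  moreover have "poly p' z = x"
    using g p(1) by (simp add: p'_def poly_monom)
  moreover have "coeff p' i \<in> V" for i
    using g_mem p(2) by (auto simp: p'_def)
  ultimately show ?thesis
    unfolding m_def by blast
qed

text \<open>If neither z nor 1/z were in V, then x would be a polynomial over V in each of them.
  With both polynomials of least degree, \<open>lower_degree\<close> shortens the longer one; in the
  second case z and 1/z exchange roles.\<close>

lemma valuation_ring: "valuation_ring V"
proof
  fix z assume z: "z \<notin> V"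
  then have "z \<noteq> 0"
    by auto
  show "inverse z \<in> V"
  proof (rule ccontr)
    assume iz: "inverse z \<notin> V"
    define P where "P z d \<longleftrightarrow> (\<exists>p. degree p = d \<and> poly p z = x \<and> (\<forall>i. coeff p i \<in> V))" for z d
    have ex: "\<exists>d. P z d" "\<exists>d. P (inverse z) d"
      using x_in_ring_adjoin[OF z] x_in_ring_adjoin[OF iz] unfolding P_def ring_adjoin_def by auto
    define d e where "d = (LEAST d. P z d)" and "e = (LEAST e. P (inverse z) e)"
    obtain p q where p: "degree p = d" "poly p z = x" "\<forall>i. coeff p i \<in> V"
      and q: "degree q = e" "poly q (inverse z) = x" "\<forall>i. coeff q i \<in> V"
      using LeastI_ex[OF ex(1)] LeastI_ex[OF ex(2)] unfolding d_def e_def P_def by metis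
    consider "e \<le> d" | "d \<le> e"
      by linarith
    then show False
    proof cases
      case 1
      then obtain p' :: "'a poly" where "degree p' < d" "P z (degree p')"
        using lower_degree[OF z \<open>z \<noteq> 0\<close> p(2,3) q(2,3)] p q unfolding P_def by auto
      then show False
        unfolding d_def using not_less_Least by blast
    next
      case 2
      then obtain p' :: "'a poly" where "degree p' < e" "P (inverse z) (degree p')"
        using lower_degree[OF iz _ q(2,3), of p] p q \<open>z \<noteq> 0\<close> unfolding P_def by auto
      then show False
        unfolding e_def using not_less_Least by blast
    qed
  qed
qed

end

text \<open>Zorn's lemma, where S shows that the family is nonempty. A ring above a member contains
  1/x automatically, so maximality holds among all larger subrings without x.\<close>

lemma exists_maximal_avoiding:
  fixes x :: "'a::field_char_0"
  assumes S: "field_subring S" "inverse x \<in> S" "x \<notin> S"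
  shows "\<exists>V. maximal_avoiding V x"
proof -
  define \<A> where "\<A> = {W. field_subring W \<and> inverse x \<in> W \<and> x \<notin> W}"
  have "\<exists>M\<in>\<A>. \<forall>W\<in>\<A>. M \<subseteq> W \<longrightarrow> W = M"
  proof (rule subset_Zorn_nonempty)
    show "\<A> \<noteq> {}"
      using S unfolding \<A>_def by auto
    show "\<Union>\<C> \<in> \<A>" if "\<C> \<noteq> {}" "subset.chain \<A> \<C>" for \<C>
    proof -
      have "field_subring (\<Union>\<C>)"
        using that by (intro subset_chain_Union_field_subring) (auto simp: subset_chain_def \<A>_def)
      then show ?thesis
        using that unfolding subset_chain_def \<A>_def by auto
    qed
  qed
  then obtain M where M: "M \<in> \<A>" "\<And>W. W \<in> \<A> \<Longrightarrow> M \<subseteq> W \<Longrightarrow> W = M"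
    by auto
  then interpret field_subring M
    by (simp add: \<A>_def)
  have "maximal_avoiding M x"
    using M by unfold_locales (auto simp: \<A>_def)
  then show ?thesis ..
qed

text \<open>Multiplying x = p(1/x) by x^d, with d the degree of p, gives x^(d+1) = r(x), where r is
  the reflected polynomial. As r has degree at most d, this is a monic integral equation for
  x.\<close>

lemma not_in_ring_adjoin_inverse:
  fixes x :: "'a::field_char_0"
  assumes "\<not> algebraic_int x"
  shows "x \<notin> ring_adjoin \<int> (inverse x)"
proof
  assume "x \<in> ring_adjoin \<int> (inverse x)"
  then obtain p where p: "x = poly p (inverse x)" "\<forall>i. coeff p i \<in> \<int>"
    unfolding ring_adjoin_def by auto
  have "x \<noteq> 0"
    using assms by auto
  define d where "d = degree p"
  define q where "q = monom 1 (Suc d) - reflect_poly p"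
  have "degree (reflect_poly p) < Suc d"
    using degree_reflect_poly_le[of p] by (simp add: d_def less_Suc_eq_le)
  then have deg: "degree q = Suc d"
    unfolding q_def diff_conv_add_uminus by (subst degree_add_eq_left) (simp_all add: degree_monom_eq)
  have "poly q x = 0"
    using \<open>x \<noteq> 0\<close> p(1) by (simp add: q_def poly_monom poly_reflect_poly_nz d_def)
  moreover have "lead_coeff q = 1"
    unfolding deg by (simp add: q_def coeff_reflect_poly d_def)
  moreover have "\<forall>i. coeff q i \<in> \<int>"
    using p(2) by (simp add: q_def coeff_reflect_poly)
  ultimately show False
    using assms algebraic_int.intros by blast
qed

text \<open>Valuation rings are integrally closed: the monic case of
  \<open>mult_root_power_mem\<close>, as 1/x \<in> V whenever x \<notin> V.\<close>

lemma (in valuation_ring) algebraic_int_mem: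
  assumes "algebraic_int x"
  shows "x \<in> V"
proof (rule ccontr)
  assume "x \<notin> V"
  obtain p where "lead_coeff p = 1" "\<forall>i. coeff p i \<in> \<int>" "poly p x = 0"
    using assms by (auto elim: algebraic_int.cases)
  moreover from this have "p \<noteq> 0"
    by auto
  ultimately have "1 * x \<in> V"
    using mult_root_power_mem[of p x] Ints_subset inverse_mem[OF \<open>x \<notin> V\<close>] by auto
  then show False
    using \<open>x \<notin> V\<close> by simp
qed

text \<open>For the harder direction, a non-integral x is missing from \<int>[1/x], and a subring
  maximal among those that contain 1/x and avoid x is a valuation ring without x.\<close>

theorem algebraic_int_iff_valuation_rings:
  fixes x :: "'a::field_char_0"
  shows "algebraic_int x \<longleftrightarrow> (\<forall>V. valuation_ring V \<longrightarrow> x \<in> V)"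
proof
  assume *: "\<forall>V. valuation_ring V \<longrightarrow> x \<in> V"
  interpret Z: field_subring "\<int> :: 'a set"
    by (rule field_subring_Ints)
  show "algebraic_int x"
  proof (rule ccontr)
    assume "\<not> algebraic_int x"
    then obtain V where "maximal_avoiding V x"
      using exists_maximal_avoiding[OF Z.field_subring_ring_adjoin mem_ring_adjoin not_in_ring_adjoin_inverse]
      by blast
    then interpret maximal_avoiding V x .
    show False
      using * valuation_ring x_notin by blast
  qed
qed (use valuation_ring.algebraic_int_mem in blast)

text \<open>An intersection of subrings is a subring, so sums and products of algebraic integers
  need no separate argument.\<close>

lemma field_subring_algebraic_int: "field_subring {x :: 'a::field_char_0. algebraic_int x}"
  by unfold_locales
    (auto simp: algebraic_int_iff_valuation_rings dest: valuation_ring.axioms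
      intro: field_subring.one_mem field_subring.diff_mem field_subring.mult_mem)

text \<open>Checked in each valuation ring: either x lies in it, or 1/x does and
  \<open>mult_root_power_mem\<close> applies.\<close>

lemma algebraic_int_lead_coeff_mult:
  fixes x :: "'a::field_char_0"
  assumes p: "\<And>i. coeff p i \<in> \<int>" and "poly p x = 0" "p \<noteq> 0"
  shows "algebraic_int (lead_coeff p * x)"
  unfolding algebraic_int_iff_valuation_rings
proof (intro allI impI)
  fix V :: "'a set"
  assume "valuation_ring V"
  then interpret valuation_ring V .
  have p': "coeff p i \<in> V" for i
    using p Ints_subset by auto
  show "lead_coeff p * x \<in> V"
  proof (cases "x \<in> V")
    case False
    then show ?thesis
      using mult_root_power_mem[OF p' assms(2,3) inverse_mem] by simp
  qed (use p' in auto)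
qed

lemma algebraic_obtain_denominator:
  fixes x :: "'a::field_char_0"
  assumes "algebraic x"
  obtains m :: int where "m \<noteq> 0" "algebraic_int (of_int m * x)"
proof -
  obtain p where p: "\<And>i. coeff p i \<in> \<int>" "p \<noteq> 0" "poly p x = 0"
    using assms unfolding algebraic_def by auto
  obtain m where "lead_coeff p = of_int m"
    using p(1) Ints_cases by blast
  moreover from this have "m \<noteq> 0"
    using p(2) by (metis leading_coeff_0_iff of_int_0)
  ultimately show ?thesis
    using that[of m] algebraic_int_lead_coeff_mult[OF p(1,3,2)] by auto
qed

section \<open>Gauss's lemma and Kronecker's theorem\<close>

context valuation_ring
begin

text \<open>The maximal ideal of V. Zero is listed separately because \<open>inverse 0 = 0\<close>
  belongs to V.\<close>

definition nonunits :: "'a set" where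
  "nonunits = {x \<in> V. x = 0 \<or> inverse x \<notin> V}"

lemma nonunits_mult: "x \<in> nonunits \<Longrightarrow> y \<in> V \<Longrightarrow> x * y \<in> nonunits"
proof -
  assume *: "x \<in> nonunits" "y \<in> V"
  have "inverse x \<in> V" if "x * y \<noteq> 0" "inverse (x * y) \<in> V"
  proof -
    have "inverse x = y * inverse (x * y)"
      using that by (simp add: field_simps)
    then show ?thesis
      by (metis *(2) mult_mem that(2))
  qed
  then show ?thesis
    using * unfolding nonunits_def by auto
qed

text \<open>One of the quotients x/y and y/x lies in V, so the sum is a V-multiple of one of the two
  nonunits.\<close>

lemma nonunits_add:
  assumes "x \<in> nonunits" "y \<in> nonunits"
  shows "x + y \<in> nonunits"
proof -
  have *: "a + b \<in> nonunits" if "a \<in> nonunits" "b \<in> nonunits" "b \<noteq> 0" "a * inverse b \<in> V" for a b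
  proof -
    have "a + b = b * (1 + a * inverse b)"
      using that(3) by (simp add: field_simps)
    then show ?thesis
      using that nonunits_mult[of b "1 + a * inverse b"] by auto
  qed
  show ?thesis
  proof (cases "x = 0 \<or> y = 0")
    case False
    then show ?thesis
      using *[of x y] *[of y x] assms inverse_mem[of "x * inverse y"]
      by (auto simp: add.commute mult.commute)
  qed (use assms in auto)
qed

lemma nonunits_sum: "(\<And>i. i \<in> A \<Longrightarrow> f i \<in> nonunits) \<Longrightarrow> sum f A \<in> nonunits"
  by (induction A rule: infinite_finite_induct) (auto simp: nonunits_add, auto simp: nonunits_def)

lemma one_plus_nonunit:
  assumes "x \<in> nonunits"
  shows "1 + x \<noteq> 0" "inverse (1 + x) \<in> V"
proof -
  have "1 \<notin> nonunits"
    by (auto simp: nonunits_def)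
  moreover have "- x \<in> nonunits"
    using nonunits_mult[OF assms, of "-1"] by auto
  moreover have "1 + x \<notin> nonunits"
    using calculation nonunits_add[of "1 + x" "- x"] by auto
  ultimately show "1 + x \<noteq> 0" "inverse (1 + x) \<in> V"
    using assms by (auto simp: nonunits_def)
qed

text \<open>Divisibility with quotient in V between arbitrary elements of the ambient field. Neither
  side has to lie in V, so polynomials with any coefficients can be compared.\<close>

definition vdvd :: "'a \<Rightarrow> 'a \<Rightarrow> bool" where
  "vdvd b a \<longleftrightarrow> (\<exists>v\<in>V. a = v * b)"

lemma vdvd_refl [simp]: "vdvd a a"
  unfolding vdvd_def by (intro bexI[of _ 1]) auto

lemma vdvd_0 [simp]: "vdvd a 0"
  unfolding vdvd_def by (intro bexI[of _ 0]) auto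

lemma vdvd_trans: "vdvd c b \<Longrightarrow> vdvd b a \<Longrightarrow> vdvd c a"
  unfolding vdvd_def using mult_mem by (metis mult.assoc)

lemma vdvd_total: "vdvd a b \<or> vdvd b a"
proof (cases "a = 0 \<or> b = 0")
  case False
  then have "b = (b * inverse a) * a" "a = inverse (b * inverse a) * b"
    by (auto simp: field_simps)
  then show ?thesis
    unfolding vdvd_def using inverse_mem by blast
qed auto

lemma vdvd_mult: "vdvd b a \<Longrightarrow> vdvd d c \<Longrightarrow> vdvd (b * d) (a * c)"
  unfolding vdvd_def using mult_mem by (metis mult.assoc mult.left_commute)

text \<open>Totality of divisibility provides a coefficient that divides all others, a generator of
  the content. Choosing the first such index makes every earlier coefficient a multiple of it by a
  nonunit, which is what singles out one term in Gauss's lemma.\<close>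

lemma obtain_content_index:
  obtains i where "\<And>k. vdvd (coeff f i) (coeff f k)"
    and "\<And>k. k < i \<Longrightarrow> \<exists>v\<in>nonunits. coeff f k = v * coeff f i"
proof -
  have "\<exists>i. \<forall>k<N. vdvd (coeff f i) (coeff f k)" for N
  proof (induction N)
    case (Suc N)
    then obtain i where "\<forall>k<N. vdvd (coeff f i) (coeff f k)" ..
    then have "\<forall>k<Suc N. vdvd (coeff f (if vdvd (coeff f i) (coeff f N) then i else N)) (coeff f k)"
      using vdvd_total[of "coeff f i" "coeff f N"] vdvd_trans by (auto simp: less_Suc_eq)
    then show ?case
      by metis
  qed auto
  then obtain i where "\<forall>k<Suc (degree f). vdvd (coeff f i) (coeff f k)"
    by blast
  then have "\<forall>k. vdvd (coeff f i) (coeff f k)"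
    by (metis coeff_eq_0 vdvd_0 not_less_eq)
  then have ex: "\<exists>i. \<forall>k. vdvd (coeff f i) (coeff f k)"
    by blast
  define j where "j = (LEAST i. \<forall>k. vdvd (coeff f i) (coeff f k))"
  have j: "\<forall>k. vdvd (coeff f j) (coeff f k)"
    unfolding j_def using ex by (rule LeastI_ex)
  have "\<exists>v\<in>nonunits. coeff f k = v * coeff f j" if "k < j" for k
  proof -
    obtain v where v: "v \<in> V" "coeff f k = v * coeff f j"
      using j unfolding vdvd_def by blast
    have "v \<in> nonunits"
    proof (rule ccontr)
      assume "v \<notin> nonunits"
      then have "v \<noteq> 0" "inverse v \<in> V"
        using v(1) by (auto simp: nonunits_def)
      then have "vdvd (coeff f k) (coeff f j)"
        unfolding vdvd_def v(2) by (intro bexI[of _ "inverse v"]) auto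
      then have "\<forall>i. vdvd (coeff f k) (coeff f i)"
        using j vdvd_trans by blast
      then show False
        using not_less_Least that unfolding j_def by blast
    qed
    then show ?thesis
      using v(2) by blast
  qed
  then show ?thesis
    using that j by blast
qed

text \<open>Let a and b be the content indices of f and g. In the coefficient of f * g at a + b, any
  term other than the one at (a, b) has a factor of index below a or below b, hence is a nonunit
  times the product of the contents. The coefficient is therefore that product times a unit, and so
  divides every product of coefficients.\<close>

lemma gauss_mult: "\<exists>m. vdvd (coeff (f * g) m) (coeff f i * coeff g j)"
proof -
  obtain a where a: "\<And>k. vdvd (coeff f a) (coeff f k)"
    "\<And>k. k < a \<Longrightarrow> \<exists>v\<in>nonunits. coeff f k = v * coeff f a"
    by (rule obtain_content_index) blast
  obtain b where b: "\<And>k. vdvd (coeff g b) (coeff g k)"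
    "\<And>k. k < b \<Longrightarrow> \<exists>v\<in>nonunits. coeff g k = v * coeff g b"
    by (rule obtain_content_index) blast
  let ?c = "coeff f a * coeff g b"
  have "\<exists>v\<in>nonunits. coeff f k * coeff g (a + b - k) = v * ?c" if "k \<le> a + b" "k \<noteq> a" for k
  proof (cases "k < a")
    case True
    then obtain v w where "v \<in> nonunits" "coeff f k = v * coeff f a"
      "w \<in> V" "coeff g (a + b - k) = w * coeff g b"
      using a(2) b(1) unfolding vdvd_def by metis
    then show ?thesis
      by (intro bexI[of _ "v * w"]) (auto intro: nonunits_mult)
  next
    case False
    then have "a + b - k < b"
      using that by auto
    then obtain v w where "v \<in> V" "coeff f k = v * coeff f a"
      "w \<in> nonunits" "coeff g (a + b - k) = w * coeff g b"
      using a(1) b(2) unfolding vdvd_def by metis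
    then show ?thesis
      by (intro bexI[of _ "w * v"]) (auto intro: nonunits_mult)
  qed
  then obtain v where v: "\<And>k. k \<le> a + b \<Longrightarrow> k \<noteq> a \<Longrightarrow>
      v k \<in> nonunits \<and> coeff f k * coeff g (a + b - k) = v k * ?c"
    by metis
  have "coeff (f * g) (a + b) = (\<Sum>k\<le>a + b. coeff f k * coeff g (a + b - k))"
    by (simp add: coeff_mult)
  also have "\<dots> = ?c + (\<Sum>k\<in>{..a + b} - {a}. coeff f k * coeff g (a + b - k))"
    by (subst sum.remove[of _ a]) auto
  also have "(\<Sum>k\<in>{..a + b} - {a}. coeff f k * coeff g (a + b - k)) = (\<Sum>k\<in>{..a + b} - {a}. v k) * ?c"
    unfolding sum_distrib_right using v by (intro sum.cong) auto
  finally have c: "coeff (f * g) (a + b) = (1 + (\<Sum>k\<in>{..a + b} - {a}. v k)) * ?c"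
    by (simp add: algebra_simps)
  have "(\<Sum>k\<in>{..a + b} - {a}. v k) \<in> nonunits"
    using v by (intro nonunits_sum) auto
  from one_plus_nonunit[OF this] have "vdvd (coeff (f * g) (a + b)) ?c"
    unfolding vdvd_def c
    by (intro bexI[of _ "inverse (1 + (\<Sum>k\<in>{..a + b} - {a}. v k))"]) (auto simp: field_simps)
  moreover have "vdvd ?c (coeff f i * coeff g j)"
    using a(1) b(1) by (rule vdvd_mult)
  ultimately show ?thesis
    using vdvd_trans by blast
qed

lemma gauss_prod: "\<exists>m. vdvd (coeff (\<Prod>k\<in>A. f k) m) (\<Prod>k\<in>A. coeff (f k) (i k))"
proof (induction A rule: infinite_finite_induct)
  case (insert k A)
  then obtain m where "vdvd (coeff (\<Prod>k\<in>A. f k) m) (\<Prod>k\<in>A. coeff (f k) (i k))"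
    by blast
  then have "vdvd (coeff (f k) (i k) * coeff (\<Prod>k\<in>A. f k) m) (\<Prod>k\<in>insert k A. coeff (f k) (i k))"
    using insert by (auto intro: vdvd_mult)
  then show ?case
    using gauss_mult[of "f k" "\<Prod>k\<in>A. f k" "i k" m] vdvd_trans insert by auto
qed (auto intro: exI[of _ 0])

end

text \<open>Kronecker's generalisation of Gauss's lemma.\<close>

theorem algebraic_int_prod_coeff_divide:
  fixes c :: "'a::field_char_0"
  assumes "\<And>m. algebraic_int (coeff (\<Prod>k\<in>A. f k) m / c)"
  shows "algebraic_int ((\<Prod>k\<in>A. coeff (f k) (i k)) / c)"
  unfolding algebraic_int_iff_valuation_rings
proof (intro allI impI)
  fix V :: "'a set"
  assume "valuation_ring V"
  then interpret valuation_ring V .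
  obtain m v where v: "v \<in> V" "(\<Prod>k\<in>A. coeff (f k) (i k)) = v * coeff (\<Prod>k\<in>A. f k) m"
    using gauss_prod[of f A i] unfolding vdvd_def by blast
  show "(\<Prod>k\<in>A. coeff (f k) (i k)) / c \<in> V"
    unfolding v(2) times_divide_eq_right[symmetric]
    using v(1) assms algebraic_int_mem by blast
qed

text \<open>Expanding the product gives sums of products with one coefficient from each factor. The
  induction varies M: once a coefficient a of the new factor is fixed, the hypothesis is applied to
  the additive set of all y with a * y \<in> M.\<close>

lemma coeff_prod_mem_additive:
  fixes f :: "'k \<Rightarrow> 'a::comm_ring_1 poly"
  assumes "finite A" and "0 \<in> M" "\<And>x y. x \<in> M \<Longrightarrow> y \<in> M \<Longrightarrow> x + y \<in> M"
    and "\<And>i. (\<Prod>k\<in>A. poly.coeff (f k) (i k)) \<in> M"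
  shows "poly.coeff (\<Prod>k\<in>A. f k) m \<in> M"
  using assms
proof (induction A arbitrary: M m rule: finite_induct)
  case empty
  then show ?case
    by (auto simp: coeff_1)
next
  case (insert k A)
  have "poly.coeff (f k) j * poly.coeff (\<Prod>k\<in>A. f k) l \<in> M" for j l
  proof -
    have "poly.coeff (\<Prod>k\<in>A. f k) l \<in> {y. poly.coeff (f k) j * y \<in> M}"
    proof (rule insert.IH)
      fix i
      have "(\<Prod>l\<in>insert k A. poly.coeff (f l) ((i(k := j)) l)) \<in> M"
        by (rule insert.prems)
      moreover have "(\<Prod>l\<in>A. poly.coeff (f l) ((i(k := j)) l)) = (\<Prod>l\<in>A. poly.coeff (f l) (i l))"
        using insert.hyps by (intro prod.cong) auto
      ultimately show "(\<Prod>k\<in>A. poly.coeff (f k) (i k)) \<in> {y. poly.coeff (f k) j * y \<in> M}"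
        using insert.hyps by simp
    qed (use insert.prems in \<open>auto simp: distrib_left\<close>)
    then show ?thesis
      by simp
  qed
  moreover have "sum g B \<in> M" if "\<And>b. b \<in> B \<Longrightarrow> g b \<in> M" for g :: "nat \<Rightarrow> 'a" and B
    using that insert.prems by (induction B rule: infinite_finite_induct) auto
  ultimately show ?case
    using insert.hyps by (simp add: coeff_mult)
qed

section \<open>Galois number fields\<close>

lemma ring_of_type_algebra_simps [simp]:
  "carrier (ring_of_type_algebra :: 'a::field ring) = UNIV"
  "x \<otimes>\<^bsub>ring_of_type_algebra\<^esub> y = x * (y :: 'a::field)"
  "\<one>\<^bsub>ring_of_type_algebra\<^esub> = (1 :: 'a::field)"
  "\<zero>\<^bsub>ring_of_type_algebra\<^esub> = (0 :: 'a::field)"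
  "x \<oplus>\<^bsub>ring_of_type_algebra\<^esub> y = x + (y :: 'a::field)"
  by (simp_all add: ring_of_type_algebra_def)

lemma a_inv_ring_of_type_algebra [simp]:
  "\<ominus>\<^bsub>ring_of_type_algebra\<^esub> x = - (x :: 'a::field)"
proof -
  interpret field "ring_of_type_algebra :: 'a ring" ..
  show ?thesis
    by (rule minus_equality) auto
qed

lemma m_inv_ring_of_type_algebra:
  "x \<noteq> 0 \<Longrightarrow> inv\<^bsub>ring_of_type_algebra\<^esub> x = inverse (x :: 'a::field)"
proof -
  assume "x \<noteq> 0"
  interpret field "ring_of_type_algebra :: 'a ring" ..
  show ?thesis
    using \<open>x \<noteq> 0\<close> by (intro comm_inv_char) auto
qed

lemma pow_ring_of_type_algebra [simp]:
  "x [^]\<^bsub>ring_of_type_algebra\<^esub> (k :: nat) = (x :: 'a::field) ^ k"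
proof -
  interpret field "ring_of_type_algebra :: 'a ring" ..
  show ?thesis
    by (induction k) (auto simp: mult.commute)
qed

lemma subring_imp_field_subring:
  fixes S :: "'a::field_char_0 set"
  assumes "subring S ring_of_type_algebra"
  shows "field_subring S"
proof
  show "1 \<in> S"
    using subringE(3)[OF assms] by simp
  show "x - y \<in> S" if "x \<in> S" "y \<in> S" for x y
    using subringE(7)[OF assms, of x "- y"] subringE(5)[OF assms, of y] that by simp
  show "x * y \<in> S" if "x \<in> S" "y \<in> S" for x y
    using subringE(6)[OF assms] that by simp
qed

lemma subfield_inverse_mem:
  fixes K :: "'a::field_char_0 set"
  assumes "subfield K ring_of_type_algebra" "x \<in> K"
  shows "inverse x \<in> K"
proof (cases "x = 0")
  case False
  interpret field "ring_of_type_algebra :: 'a ring" ..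
  show ?thesis
    using subfield_m_inv(1)[OF assms(1), of x] assms(2) m_inv_ring_of_type_algebra[of x] False by simp
qed (use assms in auto)

lemma subfield_Rats: "subfield \<rat> (ring_of_type_algebra :: 'a::field_char_0 ring)"
proof -
  interpret field "ring_of_type_algebra :: 'a ring" ..
  show ?thesis
    by (rule subfieldI', rule subringI) (auto simp: m_inv_ring_of_type_algebra)
qed

text \<open>The list polynomials of HOL-Algebra begin with the leading coefficient, whereas
  \<open>Poly\<close> expects the constant term first; hence \<open>rev\<close>.\<close>

lemma eval_ring_of_type_algebra:
  fixes x :: "'a::field"
  shows "ring.eval ring_of_type_algebra p x = poly (Poly (rev p)) x"
proof -
  interpret field "ring_of_type_algebra :: 'a ring" ..
  have "poly (Poly (xs @ [a])) x = poly (Poly xs) x + a * x ^ length xs" for xs and a :: 'a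
    by (induction xs) (auto simp: algebra_simps)
  then show ?thesis
    by (induction p) auto
qed

lemma number_field_imp_algebraic:
  fixes K :: "'a::field_char_0 set"
  assumes "number_field K" "x \<in> K"
  shows "Polynomial.algebraic x"
proof -
  interpret field "ring_of_type_algebra :: 'a ring" ..
  have K: "subfield K ring_of_type_algebra" "finite_dimension \<rat> K"
    using assms unfolding number_field_def by auto
  have x: "x \<in> carrier ring_of_type_algebra"
    by simp
  obtain p where p: "p \<in> carrier (\<rat>[X]\<^bsub>ring_of_type_algebra\<^esub>)" "p \<noteq> []" "eval p x = 0"
    using algebraicE[OF subfieldE(1)[OF subfield_Rats] x
      finite_dimension_imp_algebraic[OF subfield_Rats subfieldE(1)[OF K(1)] K(2) assms(2)]] by auto
  have set: "set p \<subseteq> \<rat>" and hd: "hd p \<noteq> 0"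
    using p(1,2) unfolding univ_poly_def polynomial_def by auto
  show ?thesis
  proof (rule algebraicI')
    show "poly (Poly (rev p)) x = 0"
      using p(3) eval_ring_of_type_algebra[of p x] by simp
    show "poly.coeff (Poly (rev p)) i \<in> \<rat>" for i
      using set by (auto simp: coeff_Poly_eq nth_default_def rev_nth)
    show "Poly (rev p) \<noteq> 0"
    proof
      assume "Poly (rev p) = 0"
      moreover have "poly.coeff (Poly (rev p)) (length p - 1) = hd p"
        using p(2) by (simp add: coeff_Poly_eq nth_default_def rev_nth hd_conv_nth)
      ultimately show False
        using hd by simp
    qed
  qed
qed

text \<open>Spanning by U is expressed through closed sets M instead of linear combinations, ready
  for M the set on which two automorphisms agree. The part 0 \<in> E is carried along so that the
  new vector v = 1 * v + 0 lies in the line extension.\<close>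

lemma dimension_generators:
  fixes E :: "'a::field_char_0 set"
  assumes "0 \<in> F" "1 \<in> F" "ring.dimension ring_of_type_algebra n F E"
  shows "0 \<in> E \<and> (\<exists>U. finite U \<and> U \<subseteq> E \<and>
    (\<forall>M. U \<subseteq> M \<longrightarrow> 0 \<in> M \<longrightarrow> (\<forall>x\<in>M. \<forall>y\<in>M. x + y \<in> M) \<longrightarrow> (\<forall>q\<in>F. \<forall>x\<in>M. q * x \<in> M) \<longrightarrow> E \<subseteq> M))"
proof -
  interpret field "ring_of_type_algebra :: 'a ring" ..
  show ?thesis
    using assms(3,1,2)
  proof (induction rule: dimension.induct)
    case (Suc_dim v E n F)
    obtain U where U: "0 \<in> E" "finite U" "U \<subseteq> E"
      "\<And>M. U \<subseteq> M \<Longrightarrow> 0 \<in> M \<Longrightarrow> (\<forall>x\<in>M. \<forall>y\<in>M. x + y \<in> M) \<Longrightarrow> (\<forall>q\<in>F. \<forall>x\<in>M. q * x \<in> M) \<Longrightarrow> E \<subseteq> M"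
      using Suc_dim.IH[OF Suc_dim.prems] by (elim conjE exE) metis
    have line: "line_extension F v E = {q * v + e | q e. q \<in> F \<and> e \<in> E}"
      unfolding line_extension_def set_add_def' r_coset_def by auto
    have "0 \<in> line_extension F v E"
      unfolding line using U(1) Suc_dim.prems by (intro CollectI exI[of _ 0]) auto
    moreover have "v \<in> line_extension F v E"
      unfolding line using U(1) Suc_dim.prems by (intro CollectI exI[of _ 1] exI[of _ 0]) auto
    moreover have "E \<subseteq> line_extension F v E"
    proof
      fix e assume "e \<in> E"
      then show "e \<in> line_extension F v E"
        unfolding line using Suc_dim.prems by (intro CollectI exI[of _ 0] exI[of _ e]) auto
    qed
    moreover have "line_extension F v E \<subseteq> M"
      if M: "insert v U \<subseteq> M" "0 \<in> M" "\<forall>x\<in>M. \<forall>y\<in>M. x + y \<in> M" "\<forall>q\<in>F. \<forall>x\<in>M. q * x \<in> M" for M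
    proof -
      have "E \<subseteq> M"
        using M by (intro U(4)) auto
      then show ?thesis
        unfolding line using M by auto
    qed
    ultimately show ?case
      using U(2,3) by (intro conjI exI[of _ "insert v U"]) auto
  qed (auto intro: exI[of _ "{}"])
qed

section \<open>The Galois group and norms of polynomials\<close>

locale galois_field =
  fixes K :: "'a::field_char_0 set"
  assumes galois: "galois_number_field K"
begin

abbreviation Gal :: "('a \<Rightarrow> 'a) monoid" where "Gal \<equiv> galois_group \<rat> K"

lemma number_field: "number_field K"
  using galois unfolding galois_number_field_def by blast

lemma subfield: "subfield K ring_of_type_algebra"
  using number_field unfolding number_field_def by blast

sublocale field_subring K
  using subring_imp_field_subring subfieldE(1) subfield by blast

lemma inverse_mem [intro]: "x \<in> K \<Longrightarrow> inverse x \<in> K"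
  using subfield_inverse_mem subfield by blast

lemma divide_mem [intro]: "x \<in> K \<Longrightarrow> y \<in> K \<Longrightarrow> x / y \<in> K"
  by (auto simp: divide_inverse)

lemma Rats_subset: "\<rat> \<subseteq> K"
proof
  fix q :: 'a assume "q \<in> \<rat>"
  then obtain a b where "q = of_int a / of_int b"
    by (auto elim: Rats_cases')
  then show "q \<in> K"
    by auto
qed

lemma Rats_mem: "q \<in> \<rat> \<Longrightarrow> q \<in> K"
  using Rats_subset by blast

lemma algebraic: "x \<in> K \<Longrightarrow> Polynomial.algebraic x"
  using number_field_imp_algebraic number_field by blast

lemma mem_Gal_iff:
  "\<sigma> \<in> carrier Gal \<longleftrightarrow> \<sigma> \<in> extensional K \<and> bij_betw \<sigma> K K \<and> \<sigma> 1 = 1 \<and>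
     (\<forall>x\<in>K. \<forall>y\<in>K. \<sigma> (x + y) = \<sigma> x + \<sigma> y \<and> \<sigma> (x * y) = \<sigma> x * \<sigma> y) \<and> (\<forall>x\<in>\<rat>. \<sigma> x = x)"
  unfolding galois_group_def Bij_def ring_hom_def by (auto simp: bij_betw_def)

lemma Gal_mult: "\<sigma> \<in> carrier Gal \<Longrightarrow> \<tau> \<in> carrier Gal \<Longrightarrow> \<sigma> \<otimes>\<^bsub>Gal\<^esub> \<tau> = compose K \<sigma> \<tau>"
  unfolding galois_group_def BijGroup_def by auto

lemma Gal_one: "\<one>\<^bsub>Gal\<^esub> = (\<lambda>x\<in>K. x)"
  unfolding galois_group_def BijGroup_def by auto

lemma Gal_mult_apply:
  "\<sigma> \<in> carrier Gal \<Longrightarrow> \<tau> \<in> carrier Gal \<Longrightarrow> x \<in> K \<Longrightarrow> (\<sigma> \<otimes>\<^bsub>Gal\<^esub> \<tau>) x = \<sigma> (\<tau> x)"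
  by (simp add: Gal_mult compose_def)

context
  fixes \<sigma> assumes \<sigma>: "\<sigma> \<in> carrier Gal"
begin

lemma aut_mem [intro]: "x \<in> K \<Longrightarrow> \<sigma> x \<in> K"
  using \<sigma> unfolding mem_Gal_iff by (auto simp: bij_betw_def)

lemma aut_add: "x \<in> K \<Longrightarrow> y \<in> K \<Longrightarrow> \<sigma> (x + y) = \<sigma> x + \<sigma> y"
  and aut_mult: "x \<in> K \<Longrightarrow> y \<in> K \<Longrightarrow> \<sigma> (x * y) = \<sigma> x * \<sigma> y"
  and aut_one: "\<sigma> 1 = 1"
  and aut_Rats: "x \<in> \<rat> \<Longrightarrow> \<sigma> x = x"
  and aut_inj: "inj_on \<sigma> K"
  and aut_image: "\<sigma> ` K = K"
  using \<sigma> unfolding mem_Gal_iff by (auto simp: bij_betw_def)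

lemma aut_zero: "\<sigma> 0 = 0"
  using aut_Rats[of 0] by simp

lemma aut_eq_zero_iff: "x \<in> K \<Longrightarrow> \<sigma> x = 0 \<longleftrightarrow> x = 0"
  using inj_onD[OF aut_inj, of x 0] aut_zero by auto

lemma aut_power: "x \<in> K \<Longrightarrow> \<sigma> (x ^ k) = \<sigma> x ^ k"
  by (induction k) (auto simp: aut_one aut_mult power_mem)

lemma aut_sum: "(\<And>i. i \<in> A \<Longrightarrow> f i \<in> K) \<Longrightarrow> \<sigma> (sum f A) = (\<Sum>i\<in>A. \<sigma> (f i))"
proof (induction A rule: infinite_finite_induct)
  case (insert i A)
  then show ?case
    by (simp add: aut_add sum_mem)
qed (auto simp: aut_zero)

lemma aut_poly: "(\<And>i. poly.coeff p i \<in> \<rat>) \<Longrightarrow> x \<in> K \<Longrightarrow> \<sigma> (poly p x) = poly p (\<sigma> x)"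
  by (auto simp: poly_altdef aut_sum Rats_mem aut_mult aut_power aut_Rats mult_mem power_mem)

lemma aut_algebraic_int:
  assumes "x \<in> K" "algebraic_int x"
  shows "algebraic_int (\<sigma> x)"
proof -
  obtain p where p: "Polynomial.lead_coeff p = 1" "\<forall>i. poly.coeff p i \<in> \<int>" "poly p x = 0"
    using assms(2) by (auto elim: algebraic_int.cases)
  then have "poly p (\<sigma> x) = 0"
    using aut_poly[of p x] assms(1) aut_zero Ints_subset_Rats by auto
  then show ?thesis
    using p algebraic_int.intros by blast
qed

lemma aut_inv_into: "restrict (inv_into K \<sigma>) K \<in> carrier Gal"
proof -
  let ?\<tau> = "restrict (inv_into K \<sigma>) K"
  have inv: "?\<tau> (\<sigma> x) = x" if "x \<in> K" for x
    using that aut_inj aut_mem by (simp add: inv_into_f_f)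
  have rat: "?\<tau> x = x" if "x \<in> \<rat>" for x
    using inv[of x] aut_Rats that Rats_subset by auto
  moreover have "bij_betw ?\<tau> K K"
    using \<sigma> bij_betw_inv_into[of \<sigma> K K] unfolding mem_Gal_iff by simp
  moreover have "?\<tau> (x + y) = ?\<tau> x + ?\<tau> y \<and> ?\<tau> (x * y) = ?\<tau> x * ?\<tau> y" if xy: "x \<in> K" "y \<in> K" for x y
  proof -
    obtain a b where "a \<in> K" "b \<in> K" "x = \<sigma> a" "y = \<sigma> b"
      using xy aut_image by (metis imageE)
    then show ?thesis
      using inv[of a] inv[of b] inv[of "a + b"] inv[of "a * b"] by (simp add: aut_add aut_mult add_mem mult_mem)
  qed
  ultimately show ?thesis
    unfolding mem_Gal_iff using rat[OF Rats_1] rat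
    by (intro conjI ballI restrict_extensional) blast+
qed

end

lemma group_Gal: "group Gal"
proof (rule groupI)
  show one_closed: "\<one>\<^bsub>Gal\<^esub> \<in> carrier Gal"
    unfolding Gal_one mem_Gal_iff by (auto simp: bij_betw_def inj_on_def Rats_mem)
  show mult_closed: "\<sigma> \<otimes>\<^bsub>Gal\<^esub> \<tau> \<in> carrier Gal" if "\<sigma> \<in> carrier Gal" "\<tau> \<in> carrier Gal" for \<sigma> \<tau>
  proof -
    have "bij_betw (compose K \<sigma> \<tau>) K K"
      using that bij_betw_compose unfolding mem_Gal_iff by blast
    then show ?thesis
      using that unfolding Gal_mult[OF that] mem_Gal_iff[of "compose _ _ _"]
      by (auto simp: Rats_mem compose_def aut_add aut_mult aut_one aut_Rats aut_mem add_mem mult_mem)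
  qed
  fix \<sigma> assume \<sigma>: "\<sigma> \<in> carrier Gal"
  show "\<one>\<^bsub>Gal\<^esub> \<otimes>\<^bsub>Gal\<^esub> \<sigma> = \<sigma>"
    using \<sigma> one_closed aut_mem[OF \<sigma>] unfolding mem_Gal_iff[of \<sigma>]
    by (auto simp: Gal_mult[OF _ \<sigma>] Gal_one compose_def intro: extensionalityI[of _ K])
  show "\<exists>\<tau>\<in>carrier Gal. \<tau> \<otimes>\<^bsub>Gal\<^esub> \<sigma> = \<one>\<^bsub>Gal\<^esub>"
  proof
    show "restrict (inv_into K \<sigma>) K \<otimes>\<^bsub>Gal\<^esub> \<sigma> = \<one>\<^bsub>Gal\<^esub>"
      unfolding Gal_mult[OF aut_inv_into[OF \<sigma>] \<sigma>] Gal_one compose_def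
      using aut_inj[OF \<sigma>] aut_mem[OF \<sigma>] by (intro restrict_ext) simp
  qed (rule aut_inv_into[OF \<sigma>])
  show "\<sigma> \<otimes>\<^bsub>Gal\<^esub> \<tau> \<otimes>\<^bsub>Gal\<^esub> \<rho> = \<sigma> \<otimes>\<^bsub>Gal\<^esub> (\<tau> \<otimes>\<^bsub>Gal\<^esub> \<rho>)"
    if \<tau>: "\<tau> \<in> carrier Gal" and \<rho>: "\<rho> \<in> carrier Gal" for \<tau> \<rho>
  proof -
    have "compose K (compose K \<sigma> \<tau>) \<rho> = compose K \<sigma> (compose K \<tau> \<rho>)"
      using aut_mem[OF \<rho>] by (auto simp: compose_def)
    then show ?thesis
      using mult_closed[OF \<sigma> \<tau>] mult_closed[OF \<tau> \<rho>] \<sigma> \<tau> \<rho> by (simp add: Gal_mult)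
  qed
qed

text \<open>An automorphism is determined by its values on a finite set U spanning K over \<rat>,
  and it sends each u in U to one of the finitely many roots of a rational polynomial vanishing at
  u.\<close>

lemma finite_Gal: "finite (carrier Gal)"
proof -
  obtain n where "ring.dimension ring_of_type_algebra n \<rat> K"
    using number_field ring.finite_dimension_def[OF ring_from_type_algebra] unfolding number_field_def by blast
  from dimension_generators[OF Rats_0 Rats_1 this] obtain U where U: "finite U" "U \<subseteq> K"
      "\<forall>M. U \<subseteq> M \<longrightarrow> 0 \<in> M \<longrightarrow> (\<forall>x\<in>M. \<forall>y\<in>M. x + y \<in> M) \<longrightarrow> (\<forall>q\<in>\<rat>. \<forall>x\<in>M. q * x \<in> M) \<longrightarrow> K \<subseteq> M"
    by (elim conjE exE) (rule that; assumption)
  have "\<exists>p. (\<forall>i. poly.coeff p i \<in> \<rat>) \<and> p \<noteq> 0 \<and> poly p u = 0" if "u \<in> U" for u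
    using algebraic[of u] that U(2) algebraic_altdef by blast
  then obtain p where p: "\<And>u i. u \<in> U \<Longrightarrow> poly.coeff (p u) i \<in> \<rat>"
    "\<And>u. u \<in> U \<Longrightarrow> p u \<noteq> 0" "\<And>u. u \<in> U \<Longrightarrow> poly (p u) u = 0"
    by metis
  let ?roots = "\<lambda>u. {x. poly (p u) x = 0}"
  have "finite (PiE U ?roots)"
    using U(1) p(2) poly_roots_finite by (intro finite_PiE) auto
  moreover have "(\<lambda>\<sigma>. restrict \<sigma> U) ` carrier Gal \<subseteq> PiE U ?roots"
  proof (intro image_subsetI restrict_PiE_iff[THEN iffD2] ballI CollectI)
    fix \<sigma> u assume "\<sigma> \<in> carrier Gal" "u \<in> U"
    then show "poly (p u) (\<sigma> u) = 0"
      using aut_poly[of \<sigma> "p u" u] p U(2) aut_zero[of \<sigma>] by auto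
  qed
  moreover have "inj_on (\<lambda>\<sigma>. restrict \<sigma> U) (carrier Gal)"
  proof (rule inj_onI)
    fix \<sigma> \<tau>
    assume \<sigma>: "\<sigma> \<in> carrier Gal" and \<tau>: "\<tau> \<in> carrier Gal" and eq: "restrict \<sigma> U = restrict \<tau> U"
    \<comment> \<open>The set of agreement of the two automorphisms is a rational subspace
      containing U, hence all of K.\<close>
    define M where "M = {x \<in> K. \<sigma> x = \<tau> x}"
    have "\<sigma> u = \<tau> u" if "u \<in> U" for u
      using fun_cong[OF eq, of u] that by simp
    then have "U \<subseteq> M"
      using U(2) unfolding M_def by blast
    moreover have "0 \<in> M" "\<forall>x\<in>M. \<forall>y\<in>M. x + y \<in> M" "\<forall>q\<in>\<rat>. \<forall>x\<in>M. q * x \<in> M"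
      unfolding M_def by (simp_all add: Rats_mem aut_zero[OF \<sigma>] aut_zero[OF \<tau>] aut_add[OF \<sigma>] aut_add[OF \<tau>]
          aut_mult[OF \<sigma>] aut_mult[OF \<tau>] aut_Rats[OF \<sigma>] aut_Rats[OF \<tau>] add_mem mult_mem)
    ultimately have "K \<subseteq> M"
      using U(3) by blast
    then show "\<sigma> = \<tau>"
      using \<sigma> \<tau> unfolding mem_Gal_iff M_def by (intro extensionalityI[of _ K]) blast+
  qed
  ultimately show ?thesis
    using finite_subset finite_imageD by blast
qed

text \<open>As \<tau> respects addition and multiplication only on K, the coefficients of all
  partial products have to be kept in K during the induction.\<close>

lemma aut_coeff_prod:
  assumes \<tau>: "\<tau> \<in> carrier Gal" and "\<And>k i. k \<in> A \<Longrightarrow> poly.coeff (f k) i \<in> K"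
  shows "\<tau> (poly.coeff (\<Prod>k\<in>A. f k) m) = poly.coeff (\<Prod>k\<in>A. map_poly \<tau> (f k)) m"
  using assms(2)
proof (induction A arbitrary: m rule: infinite_finite_induct)
  case (insert k A)
  have "poly.coeff (prod f A) i \<in> K" for i
    using insert.prems by (intro coeff_prod_mem) auto
  then show ?case
    using insert aut_zero[OF \<tau>]
    by (simp add: coeff_mult aut_sum[OF \<tau>] aut_mult[OF \<tau>] coeff_map_poly mult_mem)
qed (auto simp: coeff_1 aut_zero[OF \<tau>] aut_one[OF \<tau>])

lemma bij_betw_Gal_mult:
  assumes "\<tau> \<in> carrier Gal"
  shows "bij_betw (\<lambda>\<sigma>. \<tau> \<otimes>\<^bsub>Gal\<^esub> \<sigma>) (carrier Gal) (carrier Gal)"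
proof -
  interpret group Gal by (rule group_Gal)
  show ?thesis
    using assms inj_on_cmult surj_const_mult unfolding bij_betw_def by auto
qed

lemma mem_Rats_if_fixed:
  assumes "x \<in> K" "\<And>\<sigma>. \<sigma> \<in> carrier Gal \<Longrightarrow> \<sigma> x = x"
  shows "x \<in> \<rat>"
  using assms galois unfolding galois_number_field_def by blast

text \<open>Applying \<tau> to the coefficients permutes the factors, since left multiplication by
  \<tau> permutes the group. The coefficients are thus fixed, hence rational; being algebraic
  integers as well, they are integers.\<close>

lemma coeff_norm_poly_Ints:
  assumes f: "\<And>i. poly.coeff f i \<in> ring_of_integers K"
  shows "poly.coeff (\<Prod>\<sigma>\<in>carrier Gal. map_poly \<sigma> f) m \<in> \<int>" (is "poly.coeff ?F m \<in> _")
proof -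
  have fK: "poly.coeff f i \<in> K" and fint: "algebraic_int (poly.coeff f i)" for i
    using f unfolding ring_of_integers_def by auto
  have coeff: "poly.coeff (map_poly \<sigma> f) i = \<sigma> (poly.coeff f i)" if "\<sigma> \<in> carrier Gal" for \<sigma> i
    using aut_zero[OF that] by (simp add: coeff_map_poly)
  interpret I: field_subring "{x :: 'a. algebraic_int x}"
    by (rule field_subring_algebraic_int)
  have "poly.coeff ?F m \<in> {x. algebraic_int x}"
    using aut_algebraic_int fK fint by (intro I.coeff_prod_mem) (simp add: coeff)
  moreover have "poly.coeff ?F m \<in> \<rat>"
  proof (rule mem_Rats_if_fixed)
    show "poly.coeff ?F m \<in> K"
      using fK aut_mem by (intro coeff_prod_mem) (simp add: coeff)
    fix \<tau> assume \<tau>: "\<tau> \<in> carrier Gal"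
    interpret group Gal by (rule group_Gal)
    have "\<tau> (poly.coeff ?F m) = poly.coeff (\<Prod>\<sigma>\<in>carrier Gal. map_poly \<tau> (map_poly \<sigma> f)) m"
      using fK aut_mem by (intro aut_coeff_prod[OF \<tau>]) (simp add: coeff)
    also have "(\<Prod>\<sigma>\<in>carrier Gal. map_poly \<tau> (map_poly \<sigma> f)) = (\<Prod>\<sigma>\<in>carrier Gal. map_poly (\<tau> \<otimes>\<^bsub>Gal\<^esub> \<sigma>) f)"
    proof (rule prod.cong)
      fix \<sigma> assume \<sigma>: "\<sigma> \<in> carrier Gal"
      show "map_poly \<tau> (map_poly \<sigma> f) = map_poly (\<tau> \<otimes>\<^bsub>Gal\<^esub> \<sigma>) f"
        using \<sigma> \<tau> fK by (intro poly_eqI) (simp add: coeff coeff_map_poly aut_zero Gal_mult_apply)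
    qed auto
    also have "\<dots> = ?F"
      by (rule prod.reindex_bij_betw[OF bij_betw_Gal_mult[OF \<tau>]])
    finally show "\<tau> (poly.coeff ?F m) = poly.coeff ?F m" .
  qed
  ultimately show ?thesis
    using rational_algebraic_int_is_int by auto
qed

text \<open>The core of the argument, stated for mere sets so that it can be applied after scaling:
  S will be the algebraic integers in a multiple of the ideal, and M a multiple of its norm
  ideal.\<close>

lemma obtain_norm_generator:
  assumes S: "S \<subseteq> ring_of_integers K" "0 \<in> S" "s \<in> S" "s \<noteq> 0"
    and M: "0 \<in> M" "\<And>x y. x \<in> M \<Longrightarrow> y \<in> M \<Longrightarrow> x + y \<in> M" "\<And>x. x \<in> M \<Longrightarrow> - x \<in> M"
    and norm: "\<And>x. (\<And>\<sigma>. \<sigma> \<in> carrier Gal \<Longrightarrow> x \<sigma> \<in> S) \<Longrightarrow> (\<Prod>\<sigma>\<in>carrier Gal. \<sigma> (x \<sigma>)) \<in> M"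
  obtains c :: int where "c \<noteq> 0" "of_int c \<in> M"
    "\<And>x. (\<And>\<sigma>. \<sigma> \<in> carrier Gal \<Longrightarrow> x \<sigma> \<in> S) \<Longrightarrow> algebraic_int ((\<Prod>\<sigma>\<in>carrier Gal. \<sigma> (x \<sigma>)) / of_int c)"
proof -
  define F where "F f = (\<Prod>\<sigma>\<in>carrier Gal. map_poly \<sigma> f)" for f
  have coeff: "poly.coeff (map_poly \<sigma> f) i = \<sigma> (poly.coeff f i)" if "\<sigma> \<in> carrier Gal" for \<sigma> f i
    using aut_zero[OF that] by (simp add: coeff_map_poly)
  have F_M: "poly.coeff (F f) m \<in> M" if "\<And>i. poly.coeff f i \<in> S" for f m
    unfolding F_def using finite_Gal M(1,2)
  proof (rule coeff_prod_mem_additive)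
    fix i
    have "(\<Prod>\<sigma>\<in>carrier Gal. \<sigma> (poly.coeff f (i \<sigma>))) \<in> M"
      using that by (intro norm) auto
    then show "(\<Prod>\<sigma>\<in>carrier Gal. poly.coeff (map_poly \<sigma> f) (i \<sigma>)) \<in> M"
      by (simp add: coeff)
  qed auto
  have F_Ints: "poly.coeff (F f) m \<in> \<int>" if "\<And>i. poly.coeff f i \<in> S" for f m
    unfolding F_def using that S(1) by (intro coeff_norm_poly_Ints) auto
  have mult_M: "of_int k * x \<in> M" if "x \<in> M" for k x
  proof -
    have "of_nat l * x \<in> M" for l
      by (induction l) (auto simp: M that distrib_right)
    then show ?thesis
      by (cases k rule: int_cases2) (auto simp: M(3))
  qed
  define A where "A = {k :: int. of_int k \<in> M}"
  have "\<exists>k. k > 0 \<and> int k \<in> A"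
  proof -
    \<comment> \<open>The norm of s, read off from the constant polynomial. It is a nonzero integer
      in M, so the group A is not trivial.\<close>
    define y where "y = poly.coeff (F [:s:]) 0"
    have S': "poly.coeff [:s:] i \<in> S" for i
      using S by (auto simp: coeff_pCons split: nat.split)
    have "y = (\<Prod>\<sigma>\<in>carrier Gal. \<sigma> s)"
      by (simp add: y_def F_def coeff poly_prod flip: poly_0_coeff_0)
        (simp add: poly_0_coeff_0 coeff)
    moreover have "s \<in> K"
      using S unfolding ring_of_integers_def by auto
    ultimately have "y \<noteq> 0"
      using finite_Gal S(4) by (simp add: aut_eq_zero_iff)
    obtain k where k: "y = of_int k"
      using F_Ints[OF S'] unfolding y_def by (meson Ints_cases)
    have "k \<in> A"
      using F_M[OF S', of 0] k unfolding A_def y_def by (metis mem_Collect_eq)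
    then have "int (nat \<bar>k\<bar>) \<in> A"
      using M(3) by (auto simp: A_def abs_if)
    moreover have "nat \<bar>k\<bar> > 0"
      using \<open>y \<noteq> 0\<close> k by auto
    ultimately show ?thesis
      by blast
  qed
  \<comment> \<open>The least positive element generates A, by division with remainder in
    \<open>dvd\<close>.\<close>
  define c where "c = (LEAST k. k > 0 \<and> int k \<in> A)"
  have c: "c > 0" "int c \<in> A"
    using LeastI_ex[OF \<open>\<exists>k. k > 0 \<and> int k \<in> A\<close>] unfolding c_def by blast+
  have dvd: "int c dvd k" if "k \<in> A" for k
  proof (rule ccontr)
    assume "\<not> int c dvd k"
    then have pos: "k mod int c > 0"
    proof -
      have "k mod int c \<noteq> 0"
        using \<open>\<not> int c dvd k\<close> dvd_eq_mod_eq_0 by blast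
      moreover have "k mod int c \<ge> 0"
        by (rule pos_mod_sign) (use c(1) in linarith)
      ultimately show ?thesis
        by linarith
    qed
    have "k mod int c = k + (- (k div int c)) * int c"
      using minus_div_mult_eq_mod[of k "int c"] by simp
    then have "(of_int (k mod int c) :: 'a) = of_int k + of_int (- (k div int c)) * of_int (int c)"
      by (simp only: of_int_add of_int_mult)
    moreover have "of_int k + of_int (- (k div int c)) * of_int (int c) \<in> M"
      using that c(2) unfolding A_def by (intro M(2) mult_M) auto
    ultimately have "k mod int c \<in> A"
      unfolding A_def mem_Collect_eq by (rule ssubst)
    then have "nat (k mod int c) > 0 \<and> int (nat (k mod int c)) \<in> A"
      using pos by simp
    then have "c \<le> nat (k mod int c)"
      unfolding c_def by (rule Least_le)
    then show False
      using c(1) pos_mod_bound[of "int c" k] pos by linarith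
  qed
  show ?thesis
  proof
    show "int c \<noteq> 0" "of_int (int c) \<in> M"
      using c by (auto simp: A_def)
    fix x assume x: "\<And>\<sigma>. \<sigma> \<in> carrier Gal \<Longrightarrow> x \<sigma> \<in> S"
    obtain xs where xs: "set xs = x ` carrier Gal"
      using finite_list[of "x ` carrier Gal"] finite_Gal by auto
    \<comment> \<open>Each x \<sigma> only has to occur somewhere among the coefficients of f.
      Beyond the list the coefficients are 0, which lies in S by assumption.\<close>
    define f where "f = Poly xs"
    have fS: "poly.coeff f i \<in> S" for i
    proof (cases "i < length xs")
      case True
      then have "xs ! i \<in> x ` carrier Gal"
        using xs nth_mem by blast
      then show ?thesis
        using x True by (auto simp: f_def nth_default_def)
    qed (use S in \<open>auto simp: f_def nth_default_def\<close>)
    have "\<exists>i. poly.coeff f i = x \<sigma>" if "\<sigma> \<in> carrier Gal" for \<sigma>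
    proof -
      have "x \<sigma> \<in> set xs"
        using that xs by auto
      then show ?thesis
        unfolding in_set_conv_nth f_def by (auto simp: nth_default_def)
    qed
    then obtain i where i: "\<And>\<sigma>. \<sigma> \<in> carrier Gal \<Longrightarrow> poly.coeff f (i \<sigma>) = x \<sigma>"
      by metis
    have "algebraic_int (poly.coeff (F f) m / of_int (int c))" for m
    proof -
      obtain k where k: "poly.coeff (F f) m = of_int k"
        using F_Ints[OF fS] by (meson Ints_cases)
      then have "k \<in> A"
        using F_M[OF fS] unfolding A_def by (metis mem_Collect_eq)
      then obtain l where "k = int c * l"
        using dvd by (auto elim: dvdE)
      then have "poly.coeff (F f) m / of_int (int c) = of_int l"
        using k c(1) by simp
      then show ?thesis
        using int_imp_algebraic_int by (metis Ints_of_int)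
    qed
    \<comment> \<open>Kronecker's theorem, with the coefficient of index i \<sigma> taken from the
      factor \<sigma>(f); that coefficient is \<sigma>(x \<sigma>).\<close>
    then have "algebraic_int ((\<Prod>\<sigma>\<in>carrier Gal. poly.coeff (map_poly \<sigma> f) (i \<sigma>)) / of_int (int c))"
      unfolding F_def by (rule algebraic_int_prod_coeff_divide)
    then show "algebraic_int ((\<Prod>\<sigma>\<in>carrier Gal. \<sigma> (x \<sigma>)) / of_int (int c))"
      by (simp add: coeff i)
  qed
qed

end

section \<open>Fractional ideals\<close>

lemma additive_subgroup_ring_of_type_algebra_iff:
  fixes I :: "'a::field set"
  shows "additive_subgroup I ring_of_type_algebra \<longleftrightarrow>
    0 \<in> I \<and> (\<forall>x\<in>I. \<forall>y\<in>I. x + y \<in> I) \<and> (\<forall>x\<in>I. - x \<in> I)"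
proof -
  have "inv\<^bsub>add_monoid ring_of_type_algebra\<^esub> x = - x" for x :: 'a
    using a_inv_ring_of_type_algebra[of x] unfolding a_inv_def by simp
  then show ?thesis
    unfolding additive_subgroup_def subgroup_def by auto
qed

text \<open>The assumption \<open>denominator\<close> makes K the field of fractions of R; through
  it principal fractional ideals have a common denominator.\<close>

locale fraction_ring = K: field_subring K + R: field_subring R
  for K R :: "'a::field_char_0 set" +
  assumes inverse_in_K: "x \<in> K \<Longrightarrow> inverse x \<in> K"
    and R_subset: "R \<subseteq> K"
    and denominator: "x \<in> K \<Longrightarrow> \<exists>d\<in>R - {0}. d * x \<in> R"
begin

abbreviation Frac :: "'a set monoid" where "Frac \<equiv> fractional_ideal_group R K"
abbreviation Prin :: "'a set set" where "Prin \<equiv> principal_fractional_ideals R K"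
abbreviation iprod :: "'a set \<Rightarrow> 'a set \<Rightarrow> 'a set" where "iprod \<equiv> ideal_prod ring_of_type_algebra"

text \<open>The R-submodules of the ambient field; negatives come from -1 \<in> R.\<close>

definition stable :: "'a set \<Rightarrow> bool" where
  "stable M \<longleftrightarrow> 0 \<in> M \<and> (\<forall>x\<in>M. \<forall>y\<in>M. x + y \<in> M) \<and> (\<forall>r\<in>R. \<forall>x\<in>M. r * x \<in> M)"

lemma stable_uminus: "stable M \<Longrightarrow> x \<in> M \<Longrightarrow> - x \<in> M"
  using R.uminus_mem[OF R.one_mem] unfolding stable_def by (metis mult_minus1)

lemma mem_Frac_iff:
  "I \<in> carrier Frac \<longleftrightarrow> stable I \<and> I \<subseteq> K \<and> (\<exists>x\<in>I. x \<noteq> 0) \<and> (\<exists>d\<in>R - {0}. \<forall>x\<in>I. d * x \<in> R)"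
proof -
  have "fractional_ideal R K I \<longleftrightarrow> stable I \<and> I \<subseteq> K \<and> (\<exists>d\<in>R - {0}. \<forall>x\<in>I. d * x \<in> R)"
    using stable_uminus[of I]
    unfolding fractional_ideal_def additive_subgroup_ring_of_type_algebra_iff stable_def by blast
  moreover have "stable I \<Longrightarrow> I \<noteq> {0} \<longleftrightarrow> (\<exists>x\<in>I. x \<noteq> 0)"
    unfolding stable_def by blast
  ultimately show ?thesis
    unfolding fractional_ideal_group_def by auto
qed

lemma Frac_mult [simp]: "I \<otimes>\<^bsub>Frac\<^esub> J = iprod I J"
  and Frac_one [simp]: "\<one>\<^bsub>Frac\<^esub> = R"
  unfolding fractional_ideal_group_def by simp_all

lemma iprod_mem: "x \<in> I \<Longrightarrow> y \<in> J \<Longrightarrow> x * y \<in> iprod I J"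
  using ideal_prod.prod[of x I y J ring_of_type_algebra] by simp

lemma iprod_add: "x \<in> iprod I J \<Longrightarrow> y \<in> iprod I J \<Longrightarrow> x + y \<in> iprod I J"
  using ideal_prod.sum[of x ring_of_type_algebra I J y] by simp

text \<open>Used in place of explicit finite sums, often with M of colon form, such as the set of x
  with r * x in a given ideal.\<close>

lemma iprod_subset:
  assumes "\<And>x y. x \<in> I \<Longrightarrow> y \<in> J \<Longrightarrow> x * y \<in> M" "\<And>x y. x \<in> M \<Longrightarrow> y \<in> M \<Longrightarrow> x + y \<in> M"
  shows "iprod I J \<subseteq> M"
proof
  fix x assume "x \<in> iprod I J"
  then show "x \<in> M"
    by (induction rule: ideal_prod.induct) (auto intro: assms)
qed

lemma iprod_commute: "iprod I J = iprod J I"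
proof -
  have "iprod I J \<subseteq> iprod J I" for I J
    by (rule iprod_subset) (metis iprod_mem mult.commute, rule iprod_add)
  then show ?thesis
    by blast
qed

lemma iprod_assoc: "iprod (iprod I J) L = iprod I (iprod J L)"
proof -
  have sub: "iprod (iprod I J) L \<subseteq> iprod I (iprod J L)" for I J L
  proof (rule iprod_subset)
    fix x y assume "x \<in> iprod I J" "y \<in> L"
    moreover have "iprod I J \<subseteq> {x. \<forall>y\<in>L. x * y \<in> iprod I (iprod J L)}"
      by (rule iprod_subset) (auto simp: mult.assoc distrib_right intro: iprod_mem iprod_add)
    ultimately show "x * y \<in> iprod I (iprod J L)"
      by blast
  qed (rule iprod_add)
  \<comment> \<open>Commutativity turns \<open>sub\<close> for the reversed triple into the opposite
    inclusion.\<close>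
  show ?thesis
    using sub[of I J L] sub[of L J I] by (simp add: iprod_commute)
qed

lemma iprod_R: "stable I \<Longrightarrow> iprod R I = I"
proof
  assume I: "stable I"
  then show "iprod R I \<subseteq> I"
    unfolding stable_def by (intro iprod_subset) auto
  show "I \<subseteq> iprod R I"
    using iprod_mem[OF R.one_mem] by fastforce
qed

lemma iprod_closed:
  assumes I: "I \<in> carrier Frac" and J: "J \<in> carrier Frac"
  shows "iprod I J \<in> carrier Frac"
  unfolding mem_Frac_iff
proof (intro conjI)
  have IJ: "stable I" "stable J" "I \<subseteq> K" "J \<subseteq> K"
    using I J unfolding mem_Frac_iff by auto
  have "0 * 0 \<in> iprod I J"
    using IJ unfolding stable_def by (blast intro: iprod_mem)
  moreover have "iprod I J \<subseteq> {x. r * x \<in> iprod I J}" if "r \<in> R" for r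
  proof (rule iprod_subset)
    fix x y assume "x \<in> I" "y \<in> J"
    then have "(r * x) * y \<in> iprod I J"
      using IJ that unfolding stable_def by (blast intro: iprod_mem)
    then show "x * y \<in> {x. r * x \<in> iprod I J}"
      by (simp add: mult.assoc)
  qed (simp add: distrib_left iprod_add)
  ultimately show "stable (iprod I J)"
    unfolding stable_def using iprod_add by auto
  show "iprod I J \<subseteq> K"
    using IJ by (intro iprod_subset) auto
  obtain x y where "x \<in> I" "x \<noteq> 0" "y \<in> J" "y \<noteq> 0"
    using I J unfolding mem_Frac_iff by blast
  then show "\<exists>x\<in>iprod I J. x \<noteq> 0"
    by (intro bexI[of _ "x * y"] iprod_mem) auto
  obtain d e where de: "d \<in> R - {0}" "e \<in> R - {0}" "\<forall>x\<in>I. d * x \<in> R" "\<forall>y\<in>J. e * y \<in> R"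
    using I J unfolding mem_Frac_iff by metis
  have "iprod I J \<subseteq> {x. d * e * x \<in> R}"
  proof (rule iprod_subset)
    fix x y assume "x \<in> I" "y \<in> J"
    then have "(d * x) * (e * y) \<in> R"
      using de by blast
    then show "x * y \<in> {x. d * e * x \<in> R}"
      by (simp add: mult_ac)
  qed (auto simp: distrib_left)
  moreover have "d * e \<in> R - {0}"
    using de by auto
  ultimately show "\<exists>d\<in>R - {0}. \<forall>x\<in>iprod I J. d * x \<in> R"
    by blast
qed

lemma R_in_Frac: "R \<in> carrier Frac"
  unfolding mem_Frac_iff
proof (intro conjI)
  show "\<exists>x\<in>R. x \<noteq> 0" "\<exists>d\<in>R - {0}. \<forall>x\<in>R. d * x \<in> R"
    by (rule bexI[of _ 1]; simp)+
qed (use R_subset in \<open>auto simp: stable_def\<close>)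

sublocale comm_monoid Frac
proof (rule comm_monoidI)
  show "\<one>\<^bsub>Frac\<^esub> \<otimes>\<^bsub>Frac\<^esub> I = I" if "I \<in> carrier Frac" for I
    using that by (simp add: iprod_R mem_Frac_iff)
  show "I \<otimes>\<^bsub>Frac\<^esub> J = J \<otimes>\<^bsub>Frac\<^esub> I" for I J
    by (simp add: iprod_commute)
qed (simp_all add: iprod_closed R_in_Frac iprod_assoc)

lemma principal_in_Frac:
  assumes "x \<in> K - {0}"
  shows "(\<lambda>r. x * r) ` R \<in> carrier Frac"
  unfolding mem_Frac_iff
proof (intro conjI)
  show "stable ((\<lambda>r. x * r) ` R)"
    unfolding stable_def
  proof (intro conjI ballI)
    show "0 \<in> (\<lambda>r. x * r) ` R"
      by (rule image_eqI[of _ _ 0]) auto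
    show "a + b \<in> (\<lambda>r. x * r) ` R" if "a \<in> (\<lambda>r. x * r) ` R" "b \<in> (\<lambda>r. x * r) ` R" for a b
      using that by (auto simp flip: distrib_left)
    show "r * a \<in> (\<lambda>r. x * r) ` R" if ra: "r \<in> R" "a \<in> (\<lambda>r. x * r) ` R" for r a
    proof -
      obtain s where "s \<in> R" "r * a = x * (r * s)"
        using ra(2) by (metis imageE mult.left_commute)
      then show ?thesis
        using ra(1) R.mult_mem by blast
    qed
  qed
  show "(\<lambda>r. x * r) ` R \<subseteq> K"
    using assms R_subset by auto
  show "\<exists>y\<in>(\<lambda>r. x * r) ` R. y \<noteq> 0"
    using assms by (intro bexI[of _ "x * 1"]) auto
  obtain d where "d \<in> R - {0}" "d * x \<in> R"
    using denominator assms by blast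
  then show "\<exists>d\<in>R - {0}. \<forall>y\<in>(\<lambda>r. x * r) ` R. d * y \<in> R"
    by (intro bexI[of _ d] ballI) (auto simp: mult.assoc[symmetric])
qed

lemma Prin_subset: "Prin \<subseteq> carrier Frac"
  unfolding principal_fractional_ideals_def using principal_in_Frac by auto

lemma R_in_Prin: "R \<in> Prin"
  unfolding principal_fractional_ideals_def by (intro CollectI exI[of _ 1]) auto

lemma iprod_principal:
  "iprod ((\<lambda>r. x * r) ` R) ((\<lambda>r. y * r) ` R) = (\<lambda>r. (x * y) * r) ` R"
proof
  show "iprod ((\<lambda>r. x * r) ` R) ((\<lambda>r. y * r) ` R) \<subseteq> (\<lambda>r. (x * y) * r) ` R"
  proof (rule iprod_subset)
    fix a b assume "a \<in> (\<lambda>r. x * r) ` R" "b \<in> (\<lambda>r. y * r) ` R"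
    then obtain r s where "r \<in> R" "s \<in> R" "a = x * r" "b = y * s"
      by blast
    moreover from this have "a * b = (x * y) * (r * s)"
      by simp
    ultimately show "a * b \<in> (\<lambda>r. (x * y) * r) ` R"
      using R.mult_mem by blast
  next
    fix a b assume "a \<in> (\<lambda>r. (x * y) * r) ` R" "b \<in> (\<lambda>r. (x * y) * r) ` R"
    then obtain r s where "r \<in> R" "s \<in> R" "a = (x * y) * r" "b = (x * y) * s"
      by blast
    moreover from this have "a + b = (x * y) * (r + s)"
      by (simp add: distrib_left)
    ultimately show "a + b \<in> (\<lambda>r. (x * y) * r) ` R"
      using R.add_mem by blast
  qed
  show "(\<lambda>r. (x * y) * r) ` R \<subseteq> iprod ((\<lambda>r. x * r) ` R) ((\<lambda>r. y * r) ` R)"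
  proof (rule image_subsetI)
    fix r assume "r \<in> R"
    then have "(x * r) * (y * 1) \<in> iprod ((\<lambda>r. x * r) ` R) ((\<lambda>r. y * r) ` R)"
      by (intro iprod_mem imageI R.one_mem)
    then show "(x * y) * r \<in> iprod ((\<lambda>r. x * r) ` R) ((\<lambda>r. y * r) ` R)"
      by (simp add: mult.commute mult.left_commute)
  qed
qed

lemma Prin_iprod: "P \<in> Prin \<Longrightarrow> Q \<in> Prin \<Longrightarrow> iprod P Q \<in> Prin"
proof -
  assume "P \<in> Prin" "Q \<in> Prin"
  then obtain x y where "x \<in> K - {0}" "P = (\<lambda>r. x * r) ` R" "y \<in> K - {0}" "Q = (\<lambda>r. y * r) ` R"
    unfolding principal_fractional_ideals_def by blast
  then show ?thesis
    unfolding principal_fractional_ideals_def by (intro CollectI exI[of _ "x * y"]) (auto simp: iprod_principal)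
qed

lemma Prin_inverse:
  assumes "P \<in> Prin"
  shows "\<exists>Q\<in>Prin. iprod P Q = R"
proof -
  obtain x where x: "x \<in> K - {0}" "P = (\<lambda>r. x * r) ` R"
    using assms unfolding principal_fractional_ideals_def by blast
  have "iprod P ((\<lambda>r. inverse x * r) ` R) = R"
    using x by (simp add: iprod_principal)
  moreover have "(\<lambda>r. inverse x * r) ` R \<in> Prin"
    unfolding principal_fractional_ideals_def using x inverse_in_K by (intro CollectI exI[of _ "inverse x"]) auto
  ultimately show ?thesis
    by blast
qed

lemma prod_mem_finprod:
  assumes "finite A" "f \<in> A \<rightarrow> carrier Frac" "\<And>k. k \<in> A \<Longrightarrow> x k \<in> f k"
  shows "(\<Prod>k\<in>A. x k) \<in> finprod Frac f A"
  using assms by (induction A rule: finite_induct) (auto intro: iprod_mem)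

text \<open>A finite product of ideals is generated by products of elements, one from each ideal. As
  for coefficients of polynomials, the induction replaces M by the module of all y with a * y \<in>
  M, where a is the element chosen in the new factor.\<close>

lemma finprod_subset:
  assumes "finite A" "f \<in> A \<rightarrow> carrier Frac" "stable M"
    and "\<And>x. (\<And>k. k \<in> A \<Longrightarrow> x k \<in> f k) \<Longrightarrow> (\<Prod>k\<in>A. x k) \<in> M"
  shows "finprod Frac f A \<subseteq> M"
  using assms
proof (induction A arbitrary: M rule: finite_induct)
  case empty
  then show ?case
    \<comment> \<open>The empty product puts 1 into M, and stability then gives R \<subseteq>
      M.\<close>
    using empty.prems(2) empty.prems(3)[of "\<lambda>_. 0"] unfolding stable_def by auto (metis mult.right_neutral)
next
  case (insert k A)
  have M: "0 \<in> M" "\<And>x y. x \<in> M \<Longrightarrow> y \<in> M \<Longrightarrow> x + y \<in> M" "\<And>r x. r \<in> R \<Longrightarrow> x \<in> M \<Longrightarrow> r * x \<in> M"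
    using insert.prems(2) unfolding stable_def by auto
  have "iprod (f k) (finprod Frac f A) \<subseteq> M"
  proof (rule iprod_subset)
    fix a y assume a: "a \<in> f k" and y: "y \<in> finprod Frac f A"
    have "finprod Frac f A \<subseteq> {y. a * y \<in> M}"
    proof (rule insert.IH)
      show "stable {y. a * y \<in> M}"
        unfolding stable_def using M by (auto simp: distrib_left mult.left_commute)
      fix x assume x: "\<And>k. k \<in> A \<Longrightarrow> x k \<in> f k"
      have "(\<Prod>l\<in>insert k A. (x(k := a)) l) \<in> M"
        using a x by (intro insert.prems(3)) auto
      moreover have "(\<Prod>l\<in>A. (x(k := a)) l) = (\<Prod>l\<in>A. x l)"
        using insert.hyps by (intro prod.cong) auto
      ultimately show "(\<Prod>k\<in>A. x k) \<in> {y. a * y \<in> M}"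
        using insert.hyps by simp
    qed (use insert.prems in auto)
    then show "a * y \<in> M"
      using y by blast
  qed (rule M(2))
  then show ?case
    using insert.hyps insert.prems(1) by simp
qed

end

section \<open>The Galois action on fractional ideals\<close>

locale galois_fraction_ring = galois_field K + fraction_ring K R
  for K R :: "'a::field_char_0 set" +
  assumes aut_R: "\<sigma> \<in> carrier Gal \<Longrightarrow> x \<in> R \<Longrightarrow> \<sigma> x \<in> R"
begin

lemma aut_image_aut_inv:
  assumes "\<sigma> \<in> carrier Gal" "Z \<subseteq> K"
  shows "\<sigma> ` restrict (inv_into K \<sigma>) K ` Z = Z"
proof -
  have "\<sigma> (restrict (inv_into K \<sigma>) K x) = x" if "x \<in> Z" for x
    using that assms(2) aut_image[OF assms(1)] by (auto simp: f_inv_into_f subset_iff)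
  then have "(\<lambda>x. \<sigma> (restrict (inv_into K \<sigma>) K x)) ` Z = (\<lambda>x. x) ` Z"
    by (rule image_cong[OF refl])
  then show ?thesis
    unfolding image_image by simp
qed

text \<open>The second inclusion is the first one for the inverse automorphism, moved back by
  \<sigma>.\<close>

lemma aut_image_R:
  assumes \<sigma>: "\<sigma> \<in> carrier Gal"
  shows "\<sigma> ` R = R"
proof
  show "\<sigma> ` R \<subseteq> R"
    using aut_R[OF \<sigma>] by blast
  have "restrict (inv_into K \<sigma>) K ` R \<subseteq> R"
    using aut_R[OF aut_inv_into[OF \<sigma>]] by blast
  from image_mono[OF this, of \<sigma>] show "R \<subseteq> \<sigma> ` R"
    unfolding aut_image_aut_inv[OF \<sigma> R_subset] .
qed

lemma aut_image_iprod:
  assumes \<sigma>: "\<sigma> \<in> carrier Gal" and IJ: "I \<subseteq> K" "J \<subseteq> K"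
  shows "\<sigma> ` iprod I J = iprod (\<sigma> ` I) (\<sigma> ` J)"
proof
  have sub: "iprod I J \<subseteq> K"
    using IJ by (intro iprod_subset) auto
  have "iprod I J \<subseteq> {x \<in> K. \<sigma> x \<in> iprod (\<sigma> ` I) (\<sigma> ` J)}"
    using IJ by (intro iprod_subset) (auto simp: aut_mult[OF \<sigma>] aut_add[OF \<sigma>] subset_iff intro!: iprod_mem iprod_add)
  then show "\<sigma> ` iprod I J \<subseteq> iprod (\<sigma> ` I) (\<sigma> ` J)"
    by blast
  show "iprod (\<sigma> ` I) (\<sigma> ` J) \<subseteq> \<sigma> ` iprod I J"
  proof (rule iprod_subset)
    fix a b assume "a \<in> \<sigma> ` I" "b \<in> \<sigma> ` J"
    then obtain x y where "x \<in> I" "y \<in> J" "a = \<sigma> x" "b = \<sigma> y"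
      by blast
    then show "a * b \<in> \<sigma> ` iprod I J"
      using IJ aut_mult[OF \<sigma>, of x y] iprod_mem[of x I y J] by (metis image_eqI subsetD)
  next
    fix a b assume "a \<in> \<sigma> ` iprod I J" "b \<in> \<sigma> ` iprod I J"
    then obtain x y where "x \<in> iprod I J" "y \<in> iprod I J" "a = \<sigma> x" "b = \<sigma> y"
      by blast
    then show "a + b \<in> \<sigma> ` iprod I J"
      using sub aut_add[OF \<sigma>, of x y] iprod_add[of x I J y] by (metis image_eqI subsetD)
  qed
qed

lemma aut_image_Frac:
  assumes \<sigma>: "\<sigma> \<in> carrier Gal" and I: "I \<in> carrier Frac"
  shows "\<sigma> ` I \<in> carrier Frac"
proof -
  have "stable I" "I \<subseteq> K"
    using I unfolding mem_Frac_iff by auto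
  have "stable (\<sigma> ` I)"
    unfolding stable_def
  proof (intro conjI ballI)
    show "0 \<in> \<sigma> ` I"
      using \<open>stable I\<close> aut_zero[OF \<sigma>] unfolding stable_def by force
    show "a + b \<in> \<sigma> ` I" if ab: "a \<in> \<sigma> ` I" "b \<in> \<sigma> ` I" for a b
    proof -
      obtain x y where "x \<in> I" "y \<in> I" "a = \<sigma> x" "b = \<sigma> y"
        using ab by blast
      then show ?thesis
        using \<open>stable I\<close> \<open>I \<subseteq> K\<close> aut_add[OF \<sigma>, of x y] unfolding stable_def
        by (metis image_eqI subsetD)
    qed
    show "r * a \<in> \<sigma> ` I" if ra: "r \<in> R" "a \<in> \<sigma> ` I" for r a
    proof -
      obtain s x where "s \<in> R" "x \<in> I" "r = \<sigma> s" "a = \<sigma> x"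
        using ra aut_image_R[OF \<sigma>] by blast
      then show ?thesis
        using \<open>stable I\<close> \<open>I \<subseteq> K\<close> R_subset aut_mult[OF \<sigma>, of s x] unfolding stable_def
        by (metis image_eqI subsetD)
    qed
  qed
  moreover have "\<sigma> ` I \<subseteq> K"
    using \<open>I \<subseteq> K\<close> aut_mem[OF \<sigma>] by blast
  moreover obtain x where "x \<in> I" "x \<noteq> 0"
    using I unfolding mem_Frac_iff by blast
  then have "\<sigma> x \<in> \<sigma> ` I" "\<sigma> x \<noteq> 0"
    using aut_eq_zero_iff[OF \<sigma>] \<open>I \<subseteq> K\<close> by auto
  moreover obtain d where d: "d \<in> R - {0}" "\<forall>x\<in>I. d * x \<in> R"
    using I unfolding mem_Frac_iff by blast
  have "\<sigma> d * \<sigma> x \<in> R" if "x \<in> I" for x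
    using d that R_subset \<open>I \<subseteq> K\<close> aut_R[OF \<sigma>, of "d * x"] aut_mult[OF \<sigma>, of d x]
    by (metis DiffD1 subsetD)
  moreover have "\<sigma> d \<in> R - {0}"
    using d R_subset aut_R[OF \<sigma>] aut_eq_zero_iff[OF \<sigma>] by auto
  ultimately show ?thesis
    unfolding mem_Frac_iff by blast
qed

lemma aut_image_Prin:
  assumes \<sigma>: "\<sigma> \<in> carrier Gal" and "P \<in> Prin"
  shows "\<sigma> ` P \<in> Prin"
proof -
  obtain x where x: "x \<in> K - {0}" "P = (\<lambda>r. x * r) ` R"
    using assms(2) unfolding principal_fractional_ideals_def by blast
  have "\<sigma> ` P = (\<lambda>r. \<sigma> x * \<sigma> r) ` R"
    unfolding x(2) image_image using x(1) R_subset by (intro image_cong refl aut_mult[OF \<sigma>]) auto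
  also have "\<dots> = (\<lambda>r. \<sigma> x * r) ` R"
    using aut_image_R[OF \<sigma>] by (metis image_image)
  finally show ?thesis
    unfolding principal_fractional_ideals_def using x(1) aut_mem[OF \<sigma>] aut_eq_zero_iff[OF \<sigma>]
    by (intro CollectI exI[of _ "\<sigma> x"]) auto
qed

end

section \<open>Norms of fractional ideals and the class group\<close>

lemma (in group_hom) hom_finprod:
  assumes "comm_monoid G" "comm_monoid H" "f \<in> A \<rightarrow> carrier G"
  shows "h (finprod G f A) = finprod H (\<lambda>k. h (f k)) A"
proof -
  interpret G: comm_monoid G by fact
  interpret H: comm_monoid H by fact
  show ?thesis
    using assms(3)
  proof (induction A rule: infinite_finite_induct)
    case (insert k A)
    then have "f k \<in> carrier G" "f \<in> A \<rightarrow> carrier G"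
      by auto
    then show ?case
      using insert by (simp add: Pi_iff)
  qed simp_all
qed

text \<open>Abstracts O_K[1/n]: by \<open>localized\<close>, every element of R becomes an algebraic
  integer after multiplication by an integer that is a unit of R, there a power of n.\<close>

locale galois_number_ring = galois_field K + R: field_subring R
  for K R :: "'a::field_char_0 set" +
  assumes subset_K: "R \<subseteq> K" and integers_subset: "ring_of_integers K \<subseteq> R"
    and localized: "x \<in> R \<Longrightarrow> \<exists>k::int. k \<noteq> 0 \<and> inverse (of_int k) \<in> R \<and> algebraic_int (of_int k * x)"
begin

sublocale galois_fraction_ring K R
proof
  show "inverse x \<in> K" if "x \<in> K" for x
    using that by (rule inverse_mem)
  show "R \<subseteq> K"
    by (rule subset_K)
  show "\<exists>d\<in>R - {0}. d * x \<in> R" if x: "x \<in> K" for x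
  proof -
    obtain m :: int where m: "m \<noteq> 0" "algebraic_int (of_int m * x)"
      using algebraic_obtain_denominator[OF algebraic[OF x]] by blast
    then have "of_int m * x \<in> R"
      using integers_subset x unfolding ring_of_integers_def by auto
    then show ?thesis
      using m(1) by (intro bexI[of _ "of_int m"]) auto
  qed
  show "\<sigma> x \<in> R" if \<sigma>: "\<sigma> \<in> carrier Gal" and x: "x \<in> R" for \<sigma> x
  proof -
    obtain k :: int where k: "k \<noteq> 0" "inverse (of_int k) \<in> R" "algebraic_int (of_int k * x)"
      using localized[OF x] by blast
    \<comment> \<open>Integers are fixed by \<sigma>, so \<sigma> x is recovered from the algebraic
      integer \<sigma>(k * x) by dividing by the unit k of R.\<close>
    have xK: "x \<in> K"
      using x subset_K by blast
    have "\<sigma> (of_int k * x) = of_int k * \<sigma> x"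
      using xK aut_Rats[OF \<sigma>, of "of_int k"] by (simp add: aut_mult[OF \<sigma>])
    then have "of_int k * \<sigma> x \<in> R"
      using aut_algebraic_int[OF \<sigma> _ k(3)] xK aut_mem[OF \<sigma> xK] integers_subset
      unfolding ring_of_integers_def by auto
    then have "inverse (of_int k) * (of_int k * \<sigma> x) \<in> R"
      using k(2) by blast
    then show ?thesis
      using k(1) by (simp flip: mult.assoc)
  qed
qed

text \<open>Two scalings reduce to algebraic integers: a denominator d brings I into R, and for each
  element an integer unit of R brings d * x into O_K. The first multiplies norms by the fixed factor
  \<open>\<nu>\<close>; the second varies with x but is invertible in R.\<close>

theorem norm_in_Prin:
  assumes I: "I \<in> carrier Frac"
  shows "finprod Frac (\<lambda>\<sigma>. \<sigma> ` I) (carrier Gal) \<in> Prin"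
proof -
  let ?N = "finprod Frac (\<lambda>\<sigma>. \<sigma> ` I) (carrier Gal)"
  have images: "(\<lambda>\<sigma>. \<sigma> ` I) \<in> carrier Gal \<rightarrow> carrier Frac"
    using aut_image_Frac I by auto
  have N: "stable ?N" "?N \<subseteq> K"
    using finprod_closed[OF images] unfolding mem_Frac_iff by auto
  obtain d where d: "d \<in> R - {0}" "\<And>x. x \<in> I \<Longrightarrow> d * x \<in> R"
    using I unfolding mem_Frac_iff by metis
  have I': "stable I" "I \<subseteq> K"
    using I unfolding mem_Frac_iff by auto
  have dK: "d \<in> K" "d \<noteq> 0"
    using d subset_K by auto
  define \<nu> where "\<nu> = (\<Prod>\<sigma>\<in>carrier Gal. \<sigma> d)"
  have \<nu>: "\<nu> \<noteq> 0" "\<nu> \<in> K"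
    unfolding \<nu>_def using finite_Gal aut_eq_zero_iff dK aut_mem by auto
  have norm_mult: "(\<Prod>\<sigma>\<in>carrier Gal. \<sigma> (d * x \<sigma>)) = \<nu> * (\<Prod>\<sigma>\<in>carrier Gal. \<sigma> (x \<sigma>))"
    if "\<And>\<sigma>. \<sigma> \<in> carrier Gal \<Longrightarrow> x \<sigma> \<in> K" for x
    unfolding \<nu>_def prod.distrib[symmetric] using that dK by (intro prod.cong) (auto simp: aut_mult)
  \<comment> \<open>All of O_K that meets d * I; by \<open>scale\<close> it contains, up to a unit
    of R, every element of d * I.\<close>
  define S where "S = {d * x | x. x \<in> I} \<inter> ring_of_integers K"
  have scale: "\<exists>k::int. k \<noteq> 0 \<and> inverse (of_int k) \<in> R \<and> of_int k * x \<in> I \<and> d * (of_int k * x) \<in> S"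
    if x: "x \<in> I" for x
  proof -
    obtain k :: int where k: "k \<noteq> 0" "inverse (of_int k) \<in> R" "algebraic_int (of_int k * (d * x))"
      using localized[OF d(2)[OF x]] by blast
    have kx: "of_int k * x \<in> I"
      using I' x unfolding stable_def by blast
    then have "d * (of_int k * x) \<in> S"
      using k(3) I' dK by (auto simp: S_def ring_of_integers_def mult.left_commute)
    then show ?thesis
      using k kx by blast
  qed
  obtain x\<^sub>0 where x\<^sub>0: "x\<^sub>0 \<in> I" "x\<^sub>0 \<noteq> 0"
    using I unfolding mem_Frac_iff by blast
  obtain k\<^sub>0 :: int where k\<^sub>0: "k\<^sub>0 \<noteq> 0" "d * (of_int k\<^sub>0 * x\<^sub>0) \<in> S"
    using scale[OF x\<^sub>0(1)] by blast
  \<comment> \<open>This is \<open>\<nu>\<close> times the norm ideal, because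
    \<open>obtain_norm_generator\<close> sees the elements d * x instead of x.\<close>
  define M where "M = {y. inverse \<nu> * y \<in> ?N}"
  obtain c :: int where c: "c \<noteq> 0" "of_int c \<in> M"
    "\<And>x. (\<And>\<sigma>. \<sigma> \<in> carrier Gal \<Longrightarrow> x \<sigma> \<in> S) \<Longrightarrow> algebraic_int ((\<Prod>\<sigma>\<in>carrier Gal. \<sigma> (x \<sigma>)) / of_int c)"
  proof (rule obtain_norm_generator[of S "d * (of_int k\<^sub>0 * x\<^sub>0)" M])
    show "S \<subseteq> ring_of_integers K"
      unfolding S_def by blast
    show "0 \<in> S"
      using I' unfolding S_def stable_def ring_of_integers_def by force
    show "d * (of_int k\<^sub>0 * x\<^sub>0) \<noteq> 0"
      using dK k\<^sub>0(1) x\<^sub>0(2) by simp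
    show "0 \<in> M" "\<And>x y. x \<in> M \<Longrightarrow> y \<in> M \<Longrightarrow> x + y \<in> M"
      using N(1) unfolding M_def stable_def by (auto simp: distrib_left)
    show "- x \<in> M" if "x \<in> M" for x
      using that stable_uminus[OF N(1)] unfolding M_def by fastforce
    fix y assume y: "\<And>\<sigma>. \<sigma> \<in> carrier Gal \<Longrightarrow> y \<sigma> \<in> S"
    have "\<exists>x. x \<in> I \<and> y \<sigma> = d * x" if "\<sigma> \<in> carrier Gal" for \<sigma>
      using y[OF that] unfolding S_def by blast
    then obtain x where x: "\<And>\<sigma>. \<sigma> \<in> carrier Gal \<Longrightarrow> x \<sigma> \<in> I" "\<And>\<sigma>. \<sigma> \<in> carrier Gal \<Longrightarrow> y \<sigma> = d * x \<sigma>"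
      by metis
    have "(\<Prod>\<sigma>\<in>carrier Gal. \<sigma> (y \<sigma>)) = \<nu> * (\<Prod>\<sigma>\<in>carrier Gal. \<sigma> (x \<sigma>))"
      using norm_mult[of x] x I' by (auto cong: prod.cong)
    moreover have "(\<Prod>\<sigma>\<in>carrier Gal. \<sigma> (x \<sigma>)) \<in> ?N"
      using x by (intro prod_mem_finprod finite_Gal images) auto
    ultimately show "(\<Prod>\<sigma>\<in>carrier Gal. \<sigma> (y \<sigma>)) \<in> M"
      using \<nu>(1) unfolding M_def by (simp flip: mult.assoc)
  qed (use k\<^sub>0 in auto)
  \<comment> \<open>The integer c generates \<open>\<nu>\<close> times the norm ideal over R, so c
    divided by \<open>\<nu>\<close> generates the norm ideal.\<close>
  define g where "g = inverse \<nu> * of_int c"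
  have g: "g \<in> K - {0}"
    unfolding g_def using \<nu> c(1) by auto
  have "?N = (\<lambda>r. g * r) ` R"
  proof
    show "(\<lambda>r. g * r) ` R \<subseteq> ?N"
      using c(2) N(1) unfolding M_def g_def stable_def by (auto simp: mult.commute[of _ r for r])
    show "?N \<subseteq> (\<lambda>r. g * r) ` R"
    proof (rule finprod_subset[OF finite_Gal images])
      show "stable ((\<lambda>r. g * r) ` R)"
        using principal_in_Frac[OF g] unfolding mem_Frac_iff by blast
      fix y assume y: "\<And>\<sigma>. \<sigma> \<in> carrier Gal \<Longrightarrow> y \<sigma> \<in> \<sigma> ` I"
      have "\<exists>x k. x \<in> I \<and> y \<sigma> = \<sigma> x \<and> (k::int) \<noteq> 0 \<and> inverse (of_int k) \<in> R \<and> d * (of_int k * x) \<in> S"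
        if "\<sigma> \<in> carrier Gal" for \<sigma>
        using y[OF that] scale by (metis imageE)
      then obtain x k where x: "\<And>\<sigma>. \<sigma> \<in> carrier Gal \<Longrightarrow> x \<sigma> \<in> I" "\<And>\<sigma>. \<sigma> \<in> carrier Gal \<Longrightarrow> y \<sigma> = \<sigma> (x \<sigma>)"
        and k: "\<And>\<sigma>. \<sigma> \<in> carrier Gal \<Longrightarrow> (k \<sigma> :: int) \<noteq> 0"
          "\<And>\<sigma>. \<sigma> \<in> carrier Gal \<Longrightarrow> inverse (of_int (k \<sigma>)) \<in> R"
          "\<And>\<sigma>. \<sigma> \<in> carrier Gal \<Longrightarrow> d * (of_int (k \<sigma>) * x \<sigma>) \<in> S"
        by metis
      have xK: "\<sigma> \<in> carrier Gal \<Longrightarrow> x \<sigma> \<in> K" for \<sigma>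
        using x(1) I' by blast
      \<comment> \<open>The product of all integer multipliers. It is a unit of R, so the product of
        the y \<sigma> equals g times an element of R.\<close>
      define l :: 'a where "l = (\<Prod>\<sigma>\<in>carrier Gal. of_int (k \<sigma>))"
      define u where "u = (\<Prod>\<sigma>\<in>carrier Gal. \<sigma> (d * (of_int (k \<sigma>) * x \<sigma>))) / of_int c"
      have l: "l \<noteq> 0" "inverse l \<in> R"
        unfolding l_def using finite_Gal k(1,2) by (auto simp flip: prod_inversef intro: R.prod_mem)
      have "algebraic_int u"
        unfolding u_def by (rule c(3)) (rule k(3))
      moreover have "u \<in> K"
        unfolding u_def using xK dK aut_mem by (intro divide_mem prod_mem) auto
      ultimately have "u \<in> R"
        using integers_subset unfolding ring_of_integers_def by blast
      have "(\<Prod>\<sigma>\<in>carrier Gal. \<sigma> (d * (of_int (k \<sigma>) * x \<sigma>))) = \<nu> * (\<Prod>\<sigma>\<in>carrier Gal. \<sigma> (of_int (k \<sigma>) * x \<sigma>))"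
        using xK by (intro norm_mult) auto
      also have "(\<Prod>\<sigma>\<in>carrier Gal. \<sigma> (of_int (k \<sigma>) * x \<sigma>)) = l * (\<Prod>\<sigma>\<in>carrier Gal. y \<sigma>)"
        unfolding l_def prod.distrib[symmetric] using xK x(2) aut_Rats
        by (intro prod.cong) (auto simp: aut_mult)
      finally have "of_int c * u = \<nu> * (l * (\<Prod>\<sigma>\<in>carrier Gal. y \<sigma>))"
        using c(1) by (simp add: u_def)
      then have "(\<Prod>\<sigma>\<in>carrier Gal. y \<sigma>) = g * (inverse l * u)"
        using \<nu>(1) l(1) by (simp add: g_def field_simps)
      then show "(\<Prod>\<sigma>\<in>carrier Gal. y \<sigma>) \<in> (\<lambda>r. g * r) ` R"
        using l(2) \<open>u \<in> R\<close> by blast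
    qed
  qed
  then show ?thesis
    unfolding principal_fractional_ideals_def using g by blast
qed

lemma aut_one_image: "Z \<subseteq> K \<Longrightarrow> \<one>\<^bsub>Gal\<^esub> ` Z = Z"
  unfolding Gal_one by (auto simp: subset_iff)

text \<open>As the identity is one of the \<open>\<sigma>\<close>, principality of \<open>\<Prod>\<sigma>. \<sigma>(I)\<close> makes \<open>I\<close> invertible.\<close>

sublocale comm_group Frac
proof
  show "carrier Frac \<subseteq> Units Frac"
  proof
    fix I assume I: "I \<in> carrier Frac"
    have images: "(\<lambda>\<sigma>. \<sigma> ` I) \<in> A \<rightarrow> carrier Frac" if "A \<subseteq> carrier Gal" for A
      using aut_image_Frac I that by auto
    interpret Gal: group Gal by (rule group_Gal)
    let ?J = "finprod Frac (\<lambda>\<sigma>. \<sigma> ` I) (carrier Gal - {\<one>\<^bsub>Gal\<^esub>})"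
    have J: "?J \<in> carrier Frac"
      by (intro finprod_closed images) auto
    have "finprod Frac (\<lambda>\<sigma>. \<sigma> ` I) (insert \<one>\<^bsub>Gal\<^esub> (carrier Gal - {\<one>\<^bsub>Gal\<^esub>})) = iprod (\<one>\<^bsub>Gal\<^esub> ` I) ?J"
      using finite_Gal images[of "carrier Gal - {\<one>\<^bsub>Gal\<^esub>}"] aut_image_Frac[OF Gal.one_closed I]
      by (subst finprod_insert) auto
    moreover have "\<one>\<^bsub>Gal\<^esub> ` I = I"
      using I aut_one_image unfolding mem_Frac_iff by blast
    moreover have "insert \<one>\<^bsub>Gal\<^esub> (carrier Gal - {\<one>\<^bsub>Gal\<^esub>}) = carrier Gal"
      by auto
    ultimately have "iprod I ?J \<in> Prin"
      using norm_in_Prin[OF I] by simp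
    then obtain Q where Q: "Q \<in> Prin" "iprod (iprod I ?J) Q = R"
      using Prin_inverse by blast
    have "iprod ?J Q \<in> carrier Frac"
      using J Q(1) Prin_subset iprod_closed by blast
    moreover have "iprod I (iprod ?J Q) = R"
      using Q(2) by (simp only: iprod_assoc)
    moreover from this have "iprod (iprod ?J Q) I = R"
      by (simp only: iprod_commute[of _ I])
    ultimately show "I \<in> Units Frac"
      unfolding Units_def Frac_mult Frac_one using I by blast
  qed
qed

lemma subgroup_Prin: "subgroup Prin Frac"
proof (rule subgroupI)
  show "Prin \<subseteq> carrier Frac"
    by (rule Prin_subset)
  show "Prin \<noteq> {}"
    using R_in_Prin by blast
  show "P \<otimes>\<^bsub>Frac\<^esub> Q \<in> Prin" if "P \<in> Prin" "Q \<in> Prin" for P Q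
    using that Prin_iprod by simp
  show "inv\<^bsub>Frac\<^esub> P \<in> Prin" if P: "P \<in> Prin" for P
  proof -
    obtain Q where "Q \<in> Prin" "iprod P Q = R"
      using Prin_inverse[OF P] by blast
    moreover from this have "inv\<^bsub>Frac\<^esub> P = Q"
      using P Prin_subset by (intro inv_equality) (auto simp: iprod_commute)
    ultimately show ?thesis
      by simp
  qed
qed

abbreviation Cl :: "'a set set monoid" where "Cl \<equiv> class_group R K"

lemma normal_Prin: "Prin \<lhd> Frac"
  using subgroup_Prin normal_iff_subgroup by blast

lemma comm_group_Cl: "comm_group Cl"
  unfolding class_group_def by (rule abelian_FactGroup[OF subgroup_Prin])

lemma carrier_Cl: "carrier Cl = ideal_class R K ` carrier Frac"
  unfolding class_group_def carrier_FactGroup ideal_class_def by simp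

lemma group_hom_ideal_class: "group_hom Frac Cl (ideal_class R K)"
  using normal.r_coset_hom_Mod[OF normal_Prin] comm_group.axioms(2)[OF comm_group_Cl]
  unfolding group_hom_def group_hom_axioms_def ideal_class_def[abs_def] class_group_def
  by (auto simp: is_group)

text \<open>Since \<sigma> permutes the principal ideals and respects products of ideals, its
  elementwise image of a coset is again a coset. The action is thus defined without choosing a
  representative, and its value is the class of \<sigma>(P) for any P in the coset.\<close>

lemma image_ideal_class:
  assumes \<sigma>: "\<sigma> \<in> carrier Gal" and P: "P \<in> carrier Frac"
  shows "(\<lambda>Z. \<sigma> ` Z) ` ideal_class R K P = ideal_class R K (\<sigma> ` P)"
proof -
  have sub: "Q \<subseteq> K" if "Q \<in> carrier Frac" for Q
    using that unfolding mem_Frac_iff by blast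
  have "(\<lambda>Z. \<sigma> ` Z) ` Prin = Prin"
  proof
    show "(\<lambda>Z. \<sigma> ` Z) ` Prin \<subseteq> Prin"
      using aut_image_Prin[OF \<sigma>] by blast
    show "Prin \<subseteq> (\<lambda>Z. \<sigma> ` Z) ` Prin"
    proof
      fix Q assume Q: "Q \<in> Prin"
      have "Q = \<sigma> ` restrict (inv_into K \<sigma>) K ` Q"
        using aut_image_aut_inv[OF \<sigma>] Q Prin_subset sub by (metis subsetD)
      moreover have "restrict (inv_into K \<sigma>) K ` Q \<in> Prin"
        using aut_image_Prin[OF aut_inv_into[OF \<sigma>] Q] .
      ultimately show "Q \<in> (\<lambda>Z. \<sigma> ` Z) ` Prin"
        by (rule image_eqI)
    qed
  qed
  have coset: "ideal_class R K Q = (\<lambda>H. iprod H Q) ` Prin" for Q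
    unfolding ideal_class_def r_coset_def by auto
  have "(\<lambda>Z. \<sigma> ` Z) ` ideal_class R K P = (\<lambda>H. iprod (\<sigma> ` H) (\<sigma> ` P)) ` Prin"
    unfolding coset image_image
    using Prin_subset sub P by (intro image_cong refl aut_image_iprod[OF \<sigma>]) auto
  also have "\<dots> = (\<lambda>H. iprod H (\<sigma> ` P)) ` ((\<lambda>Z. \<sigma> ` Z) ` Prin)"
    unfolding image_image ..
  also have "\<dots> = ideal_class R K (\<sigma> ` P)"
    unfolding coset \<open>(\<lambda>Z. \<sigma> ` Z) ` Prin = Prin\<close> ..
  finally show ?thesis .
qed

lemma ideal_class_Prin: "P \<in> Prin \<Longrightarrow> ideal_class R K P = \<one>\<^bsub>Cl\<^esub>"
  unfolding ideal_class_def class_group_def one_FactGroup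
  using coset_join2[OF _ subgroup_Prin] Prin_subset by blast

theorem norm_like_action_class_group: "norm_like_action Gal Cl (\<lambda>\<sigma> C. (\<lambda>Z. \<sigma> ` Z) ` C)"
  unfolding norm_like_action_def
proof (intro conjI ballI)
  interpret Gal: group Gal by (rule group_Gal)
  interpret Cl: comm_group Cl by (rule comm_group_Cl)
  interpret cl: group_hom Frac Cl "ideal_class R K" by (rule group_hom_ideal_class)
  show "group Gal" "comm_group Cl" "finite (carrier Gal)"
    by (rule group_Gal comm_group_Cl finite_Gal)+
  have sub: "P \<subseteq> K" if "P \<in> carrier Frac" for P
    using that unfolding mem_Frac_iff by blast
  fix a assume "a \<in> carrier Cl"
  then obtain P where P: "P \<in> carrier Frac" "a = ideal_class R K P"
    unfolding carrier_Cl by blast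
  show "(\<lambda>Z. \<one>\<^bsub>Gal\<^esub> ` Z) ` a = a"
    using aut_one_image sub P by (simp add: image_ideal_class)
  show "finprod Cl (\<lambda>\<sigma>. (\<lambda>Z. \<sigma> ` Z) ` a) (carrier Gal) = \<one>\<^bsub>Cl\<^esub>"
  proof -
    \<comment> \<open>The class map is a homomorphism, so the product of the classes is the class of
      \<Prod>\<sigma>. \<sigma>(P), which is principal.\<close>
    have "finprod Cl (\<lambda>\<sigma>. (\<lambda>Z. \<sigma> ` Z) ` a) (carrier Gal) = finprod Cl (\<lambda>\<sigma>. ideal_class R K (\<sigma> ` P)) (carrier Gal)"
      using P aut_image_Frac by (intro Cl.finprod_cong') (auto simp: image_ideal_class)
    also have "\<dots> = ideal_class R K (finprod Frac (\<lambda>\<sigma>. \<sigma> ` P) (carrier Gal))"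
      using P(1) aut_image_Frac
      by (intro cl.hom_finprod[symmetric] comm_monoid_axioms Cl.comm_monoid_axioms) auto
    also have "\<dots> = \<one>\<^bsub>Cl\<^esub>"
      using ideal_class_Prin norm_in_Prin[OF P(1)] by blast
    finally show ?thesis .
  qed
  fix \<sigma> assume \<sigma>: "\<sigma> \<in> carrier Gal"
  show "(\<lambda>Z. \<sigma> ` Z) ` a \<in> carrier Cl"
    using P \<sigma> aut_image_Frac by (simp add: image_ideal_class)
  show "(\<lambda>Z. \<sigma> ` Z) ` (a \<otimes>\<^bsub>Cl\<^esub> b) = (\<lambda>Z. \<sigma> ` Z) ` a \<otimes>\<^bsub>Cl\<^esub> (\<lambda>Z. \<sigma> ` Z) ` b" if "b \<in> carrier Cl" for b
  proof -
    obtain Q where Q: "Q \<in> carrier Frac" "b = ideal_class R K Q"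
      using \<open>b \<in> carrier Cl\<close> unfolding carrier_Cl by blast
    have "(\<lambda>Z. \<sigma> ` Z) ` (a \<otimes>\<^bsub>Cl\<^esub> b) = ideal_class R K (\<sigma> ` iprod P Q)"
      using P Q \<sigma> iprod_closed by (simp add: image_ideal_class flip: cl.hom_mult)
    also have "\<dots> = ideal_class R K (\<sigma> ` P \<otimes>\<^bsub>Frac\<^esub> \<sigma> ` Q)"
      using P Q \<sigma> sub by (simp add: aut_image_iprod)
    also have "\<dots> = ideal_class R K (\<sigma> ` P) \<otimes>\<^bsub>Cl\<^esub> ideal_class R K (\<sigma> ` Q)"
      using P(1) Q(1) \<sigma> aut_image_Frac by (intro cl.hom_mult) auto
    finally show ?thesis
      using P Q \<sigma> by (simp add: image_ideal_class)
  qed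
  show "(\<lambda>Z. \<sigma> ` Z) ` (\<lambda>Z. \<tau> ` Z) ` a = (\<lambda>Z. (\<sigma> \<otimes>\<^bsub>Gal\<^esub> \<tau>) ` Z) ` a" if \<tau>: "\<tau> \<in> carrier Gal" for \<tau>
  proof -
    have "(\<sigma> \<otimes>\<^bsub>Gal\<^esub> \<tau>) ` P = \<sigma> ` \<tau> ` P"
      unfolding image_image using sub[OF P(1)] \<sigma> \<tau> by (intro image_cong refl Gal_mult_apply) auto
    then show ?thesis
      using P \<sigma> \<tau> aut_image_Frac by (simp add: image_ideal_class)
  qed
qed

end

section \<open>The ring O_K[1/n] and the conclusion\<close>

lemma mem_ring_adjoin_inverse_iff:
  fixes b :: "'a::field_char_0"
  assumes "field_subring S" "b \<in> S" "b \<noteq> 0"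
  shows "x \<in> ring_adjoin S (1 / b) \<longleftrightarrow> (\<exists>k. b ^ k * x \<in> S)"
proof -
  interpret field_subring S by fact
  interpret A: field_subring "ring_adjoin S (1 / b)"
    by (rule field_subring_ring_adjoin)
  show ?thesis
  proof
    assume "x \<in> ring_adjoin S (1 / b)"
    then obtain p where p: "x = poly p (1 / b)" "\<forall>i. poly.coeff p i \<in> S"
      unfolding ring_adjoin_def by auto
    \<comment> \<open>The power of b given by the degree is a common denominator for a polynomial in
      1/b.\<close>
    have "b ^ Polynomial.degree p * x = (\<Sum>i\<le>Polynomial.degree p. poly.coeff p i * b ^ (Polynomial.degree p - i))"
      unfolding p(1) poly_altdef sum_distrib_left using assms(3)
      by (intro sum.cong) (auto simp: power_diff field_simps)
    then have "b ^ Polynomial.degree p * x \<in> S"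
      using p(2) assms(2) by auto
    then show "\<exists>k. b ^ k * x \<in> S" ..
  next
    assume "\<exists>k. b ^ k * x \<in> S"
    then obtain k where "b ^ k * x \<in> S" ..
    then have "b ^ k * x \<in> ring_adjoin S (1 / b)"
      using ring_adjoin_superset[OF zero_mem] by blast
    then have "(1 / b) ^ k * (b ^ k * x) \<in> ring_adjoin S (1 / b)"
      using mem_ring_adjoin[of S "1 / b"] by auto
    then show "x \<in> ring_adjoin S (1 / b)"
      using assms(3) by (simp add: power_divide)
  qed
qed

text \<open>The multiplier demanded by \<open>localized\<close> is a power of n: it clears the
  denominator of x, and its inverse is a power of the adjoined element 1/n.\<close>

lemma (in galois_field) galois_number_ring_ring_adjoin:
  assumes "n \<noteq> 0"
  shows "galois_number_ring K (ring_adjoin (ring_of_integers K) (1 / of_int n))"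
proof -
  interpret I: field_subring "{x :: 'a. algebraic_int x}"
    by (rule field_subring_algebraic_int)
  interpret O: field_subring "ring_of_integers K"
    unfolding ring_of_integers_def using I.diff_mem I.mult_mem by unfold_locales auto
  interpret R: field_subring "ring_adjoin (ring_of_integers K) (1 / of_int n)"
    by (rule O.field_subring_ring_adjoin)
  note iff = mem_ring_adjoin_inverse_iff[OF O.field_subring_axioms O.of_int_mem, of n]
  show ?thesis
  proof
    show "ring_of_integers K \<subseteq> ring_adjoin (ring_of_integers K) (1 / of_int n)"
      by (rule ring_adjoin_superset) simp
    fix x assume x: "x \<in> ring_adjoin (ring_of_integers K) (1 / of_int n)"
    then obtain k where k: "of_int n ^ k * x \<in> ring_of_integers K"
      using iff assms by auto
    have "(1 / of_int n) ^ k \<in> ring_adjoin (ring_of_integers K) (1 / of_int n)"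
      by (intro R.power_mem mem_ring_adjoin) auto
    then show "\<exists>k::int. k \<noteq> 0 \<and> inverse (of_int k) \<in> ring_adjoin (ring_of_integers K) (1 / of_int n) \<and> algebraic_int (of_int k * x)"
      using k assms by (intro exI[of _ "n ^ k"]) (auto simp: ring_of_integers_def field_simps)
  next
    show "ring_adjoin (ring_of_integers K) (1 / of_int n) \<subseteq> K"
      unfolding ring_adjoin_def ring_of_integers_def by (auto intro!: poly_mem divide_mem)
  qed
qed

theorem theorem4p5:
  fixes K :: "'a::field_char_0 set" and n :: int
  assumes "galois_number_field K" and "n \<noteq> 0"
  shows "let R = ring_adjoin (ring_of_integers K) (1 / of_int n);
             Gal = galois_group \<rat> K;
             Frac = fractional_ideal_group R K;
             Cl = class_group R K
         in (\<forall>\<sigma>\<in>carrier Gal. \<forall>P\<in>carrier Frac. \<sigma> ` P \<in> carrier Frac) \<and>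
            (\<forall>\<sigma>\<in>carrier Gal. \<forall>P\<in>carrier Frac. \<forall>Q\<in>carrier Frac.
               ideal_class R K P = ideal_class R K Q \<longrightarrow>
               ideal_class R K (\<sigma> ` P) = ideal_class R K (\<sigma> ` Q)) \<and>
            (\<exists>act. (\<forall>\<sigma>\<in>carrier Gal. \<forall>P\<in>carrier Frac.
                      act \<sigma> (ideal_class R K P) = ideal_class R K (\<sigma> ` P)) \<and>
                   norm_like_action Gal Cl act)"
proof -
  interpret galois_field K
    using assms(1) by unfold_locales
  interpret galois_number_ring K "ring_adjoin (ring_of_integers K) (1 / of_int n)"
    by (rule galois_number_ring_ring_adjoin[OF assms(2)])
  show ?thesis
    unfolding Let_def
  \<comment> \<open>The witness for \<open>act\<close> is the elementwise image of a coset;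
    \<open>image_ideal_class\<close> yields both its formula on classes and independence of the
    representative.\<close>
  proof (intro conjI ballI impI exI[of _ "\<lambda>\<sigma> C. (\<lambda>Z. \<sigma> ` Z) ` C"])
    fix \<sigma> P Q
    assume "\<sigma> \<in> carrier Gal" "P \<in> carrier Frac" "Q \<in> carrier Frac"
      "ideal_class (ring_adjoin (ring_of_integers K) (1 / of_int n)) K P =
       ideal_class (ring_adjoin (ring_of_integers K) (1 / of_int n)) K Q"
    then show "ideal_class (ring_adjoin (ring_of_integers K) (1 / of_int n)) K (\<sigma> ` P) =
       ideal_class (ring_adjoin (ring_of_integers K) (1 / of_int n)) K (\<sigma> ` Q)"
      by (metis image_ideal_class)
  qed (use aut_image_Frac image_ideal_class norm_like_action_class_group in auto)
qed

end
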